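(* Let $A\in\mathbb{R}^{n\times n}$ be a symmetric positive semidefinite matrix and let $x^*$ be any solution of $Ax=b$. Fix a subset $\mathcal S\subseteq[n]$, let $A^\circ=A-A_{:,\mathcal S}(A_{\mathcal S,\mathcal S})^\dagger A_{\mathcal S,:}$ (assumed nonzero), let $x^0$ satisfy $A_{\mathcal S,:}x^0=b_{\mathcal S}$, and let $\{x^k\}_{k\ge0}$ be defined by $$x^{k+1}=x^k-e_{\mathcal J}\alpha^k+e_{\mathcal S}\beta^k,\qquad \alpha^k=(A^\circ_{\mathcal J,\mathcal J})^\dagger(A_{\mathcal J,:}x^k-b_{\mathcal J}),\qquad \beta^k=(A_{\mathcal S,\mathcal S})^\dagger A_{\mathcal S,\mathcal J}\,\alpha^k,$$ where the block $\mathcal J=\{j_1,\dots,j_\ell\}$ in each iteration consists of $\ell$ coordinates independently sampled according to the distribution $\operatorname{diag}(A^\circ)/\operatorname{tr}(A^\circ)$ (independently across iterations). Then for all $k\ge0$ $$\mathbb{E}\|x^k-x^*\|_A^2\le\left(1-\frac{\lambda_{\min}^+(A^\circ)}{\operatorname{tr}(A^\circ)}\right)^{k\ell}\|x^0-x^*\|_A^2.$$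
   Context: Notation: $[n]=\{1,\dots,n\}$; $M_{\mathcal I,\mathcal J}$ is the submatrix with rows $\mathcal I$ and columns $\mathcal J$ (":" means all indices), $v_{\mathcal J}$ the subvector; $e_{\mathcal J}\in\mathbb{R}^{n\times|\mathcal J|}$ has as columns the standard basis vectors indexed by $\mathcal J$; $M^\dagger$ is the Moore–Penrose pseudoinverse; $\|z\|_A=\sqrt{z^{\mathsf T}Az}$; $\lambda_{\min}^+$ is the smallest non-zero eigenvalue. The sampling distribution assigns index $j$ probability $A^\circ_{j,j}/\operatorname{tr}(A^\circ)$; repeated indices in a block are merged. *)

theory Defs
  imports
    "HOL-Probability.Probability"
    "Jordan_Normal_Form.Char_Poly"
    "Jordan_Normal_Form.DL_Submatrix"
begin

(* Indices are 0-based: the index set {1,...,n} is {..<n}. The submatrix with rows I and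
   columns J is submatrix M I J, with UNIV for "all indices". *)

definition subvec :: "'a Matrix.vec \<Rightarrow> nat set \<Rightarrow> 'a Matrix.vec" where
  "subvec v J = Matrix.vec (card {i. i < dim_vec v \<and> i \<in> J}) (\<lambda>i. vec_index v (pick J i))"

(* Columns indexed by J of the identity. *)
definition basis_cols :: "nat \<Rightarrow> nat set \<Rightarrow> real Matrix.mat" where
  "basis_cols n J = submatrix (1\<^sub>m n) UNIV J"

definition psd_mat :: "real Matrix.mat \<Rightarrow> bool" where
  "psd_mat M \<longleftrightarrow> transpose_mat M = M \<and>
     (\<forall>v \<in> carrier_vec (dim_row M). 0 \<le> scalar_prod v (M *\<^sub>v v))"

definition trace_mat :: "real Matrix.mat \<Rightarrow> real" where
  "trace_mat M = (\<Sum>i<dim_row M. M $$ (i, i))"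

(* The unique matrix satisfying the four Penrose conditions. *)
definition pinv :: "real Matrix.mat \<Rightarrow> real Matrix.mat" where
  "pinv M = (THE P. P \<in> carrier_mat (dim_col M) (dim_row M) \<and>
     M * P * M = M \<and> P * M * P = P \<and>
     transpose_mat (M * P) = M * P \<and> transpose_mat (P * M) = P * M)"

definition mat_norm :: "real Matrix.mat \<Rightarrow> real Matrix.vec \<Rightarrow> real" where
  "mat_norm M z = sqrt (scalar_prod z (M *\<^sub>v z))"

(* Only meaningful for a matrix that has a non-zero eigenvalue, for instance
   a non-zero symmetric one. *)
definition lambda_min_pos :: "real Matrix.mat \<Rightarrow> real" where
  "lambda_min_pos M = Min {e. eigenvalue M e \<and> e \<noteq> 0}"

definition residual_mat :: "real Matrix.mat \<Rightarrow> nat set \<Rightarrow> real Matrix.mat" where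
  "residual_mat A S = A - submatrix A UNIV S * pinv (submatrix A S S) * submatrix A S UNIV"

definition block_step ::
  "real Matrix.mat \<Rightarrow> real Matrix.vec \<Rightarrow> nat set \<Rightarrow> nat set \<Rightarrow> real Matrix.vec \<Rightarrow> real Matrix.vec" where
  "block_step A b S J x =
     (let n = dim_row A;
          \<alpha> = pinv (submatrix (residual_mat A S) J J) *\<^sub>v (submatrix A J UNIV *\<^sub>v x - subvec b J);
          \<beta> = pinv (submatrix A S S) *\<^sub>v (submatrix A S J *\<^sub>v \<alpha>)
      in x - basis_cols n J *\<^sub>v \<alpha> + basis_cols n S *\<^sub>v \<beta>)"

end

theory Submission
  imports Defs "Jordan_Normal_Form.Schur_Decomposition" "Jordan_Normal_Form.Spectral_Radius"
begin

text \<open>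
  Write \<open>x'\<close> for the next iterate, \<open>R\<close> for the residual matrix, \<open>e = x - xstar\<close> for the
  error and \<open>E\<close>, \<open>F\<close> for the identity columns indexed by \<open>S\<close> and by the sampled block \<open>J\<close>.

  The correction through \<open>\<beta>\<close> keeps the equations of \<open>S\<close> solved. As long as they hold,
  \<open>A e = R e\<close>, and one step replaces the squared A-norm of \<open>e\<close> by the minimum of the quadratic
  form \<open>v \<bullet> R v\<close> over all \<open>v\<close> that differ from \<open>e\<close> only in the coordinates of \<open>J\<close>
  (\<open>block_step_as_minimizer\<close>, \<open>block_step_energy_le\<close>). Because a minimum over more coordinates is
  at most the result of any descent inside them, the \<open>l\<close> indices of a block can be treated as if
  they arrived one by one: adding an index \<open>j\<close> to the block gains at least what one exact line
  search along coordinate \<open>j\<close> gains, \<open>((R u) $ j)\<^sup>2 / R $$ (j, j)\<close> at the current minimizer \<open>u\<close>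
  (\<open>block_step_insert_energy_le\<close>). Sampling \<open>j\<close> with probability \<open>R $$ (j, j) / trace R\<close> cancels
  the denominator, so that the expected gain is \<open>(R u \<bullet> R u) / trace R\<close>. By the spectral
  decomposition this is at least \<open>\<lambda> / trace R\<close> times \<open>u \<bullet> R u\<close>, where \<open>\<lambda>\<close> is the smallest
  non-zero eigenvalue (\<open>rayleigh_lambda_min_pos\<close>). Hence every single index contracts the
  expected energy by the factor \<open>1 - \<lambda> / trace R\<close>, and \<open>k\<close> blocks of \<open>l\<close> indices give the
  exponent \<open>k * l\<close> (\<open>expected_energy_bound\<close>).

  Three facts support this. Real symmetric matrices have an eigenvector
  decomposition (\<open>symmetric_eigenvector_sum\<close>), obtained from a complex triangularization; it
  yields both the Rayleigh bound and the existence of the pseudoinverse of a symmetric matrix.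
  For a positive semidefinite \<open>A\<close> and any \<open>E\<close>, the Gram matrix \<open>B = E\<^sup>T A E\<close> satisfies
  \<open>B B\<^sup>\<dagger> E\<^sup>T A = E\<^sup>T A\<close> (\<open>pinv_gram\<close>), which makes the pseudoinverses in the algorithm solve the
  normal equations exactly. And the next index is independent of every quantity that is
  determined by the earlier ones (\<open>expected_decrease\<close>).
\<close>

unbundle no vec_syntax
unbundle no inner_syntax

section \<open>Spectral decomposition of a real symmetric matrix\<close>

text \<open>The eigenvectors are indexed by their real eigenvalues, one per eigenvalue, so that
  for a Hermitian \<open>B\<close> the summands are pairwise orthogonal.\<close>

definition splits_into_eigenvectors :: "complex Matrix.mat \<Rightarrow> complex Matrix.vec \<Rightarrow> bool" where
  "splits_into_eigenvectors B v \<longleftrightarrow>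
     (\<exists>(E :: real set) w. finite E \<and>
        (\<forall>e\<in>E. w e \<in> carrier_vec (dim_vec v) \<and> B *\<^sub>v w e = complex_of_real e \<cdot>\<^sub>v w e) \<and>
        (\<forall>i<dim_vec v. v $ i = (\<Sum>e\<in>E. w e $ i)))"

lemma hermitian_adjoint:
  fixes A :: "real Matrix.mat"
  assumes A: "A \<in> carrier_mat n n" and sym: "transpose_mat A = A"
    and u: "u \<in> carrier_vec n" and v: "v \<in> carrier_vec n"
  defines "B \<equiv> map_mat complex_of_real A"
  shows "(B *\<^sub>v u) \<bullet>c v = u \<bullet>c (B *\<^sub>v v)"
proof -
  have B: "B \<in> carrier_mat n n" using A by (simp add: B_def)
  have symB: "transpose_mat B = B"
    using sym unfolding B_def by (metis map_mat_transpose)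
  have "conjugate (B *\<^sub>v v) = B *\<^sub>v conjugate v"
    using A v unfolding B_def
    by (intro eq_vecI) (auto simp: scalar_prod_def)
  moreover have "(B *\<^sub>v u) \<bullet> conjugate v = conjugate v \<bullet> (B *\<^sub>v u)"
    using B u v by (intro comm_scalar_prod[of _ n]) auto
  moreover have "\<dots> = (B *\<^sub>v conjugate v) \<bullet> u"
    using transpose_vec_mult_scalar[OF B u, of "conjugate v"] symB v by simp
  moreover have "\<dots> = u \<bullet> (B *\<^sub>v conjugate v)"
    using B u v by (intro comm_scalar_prod[of _ n]) auto
  ultimately show ?thesis by simp
qed

text \<open>A Hermitian matrix has no Jordan block of size two or more. If \<open>u = (B - e) v\<close> is non-zero
  and an eigenvector for \<open>e\<close>, then \<open>e\<close> is real, and moving \<open>B - e\<close> to the other side shows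
  \<open>\<langle>u, u\<rangle> = \<langle>v, (B - e) u\<rangle> = 0\<close>.\<close>

lemma hermitian_no_generalized_eigenvector:
  fixes A :: "real Matrix.mat" and e :: complex
  assumes A: "A \<in> carrier_mat n n" and sym: "transpose_mat A = A"
    and v: "v \<in> carrier_vec n"
  defines "B \<equiv> map_mat complex_of_real A"
  assumes u_def: "u = B *\<^sub>v v - e \<cdot>\<^sub>v v" and Bu: "B *\<^sub>v u = e \<cdot>\<^sub>v u"
  shows "u = 0\<^sub>v n"
proof -
  have B: "B \<in> carrier_mat n n" using A by (simp add: B_def)
  have u: "u \<in> carrier_vec n" using B v u_def by auto
  have cu: "conjugate u \<in> carrier_vec n" using u by auto
  note adj = hermitian_adjoint[OF A sym, folded B_def]
  have "e * (u \<bullet>c u) = (B *\<^sub>v u) \<bullet>c u" using u Bu by simp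
  also have "\<dots> = u \<bullet>c (e \<cdot>\<^sub>v u)" using adj[OF u u] Bu by simp
  also have "\<dots> = cnj e * (u \<bullet>c u)" using u by (simp add: conjugate_smult_vec)
  finally have real: "u \<bullet>c u = 0 \<or> cnj e = e" by auto
  have "u \<bullet>c u = (B *\<^sub>v v) \<bullet>c u - e * (v \<bullet>c u)"
  proof -
    have "u \<bullet>c u = (B *\<^sub>v v - e \<cdot>\<^sub>v v) \<bullet>c u" by (simp flip: u_def)
    also have "\<dots> = (B *\<^sub>v v) \<bullet>c u - (e \<cdot>\<^sub>v v) \<bullet>c u"
      using B v cu by (intro minus_scalar_prod_distrib) auto
    finally show ?thesis using v cu by simp
  qed
  also have "(B *\<^sub>v v) \<bullet>c u = v \<bullet>c (e \<cdot>\<^sub>v u)" using adj[OF v u] Bu by simp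
  also have "\<dots> = cnj e * (v \<bullet>c u)" using v u by (simp add: conjugate_smult_vec)
  finally have "u \<bullet>c u = 0" using real by auto
  then show ?thesis using conjugate_square_eq_0_vec[OF u] by simp
qed

text \<open>The induction step of the decomposition: the components of \<open>(B - e) v\<close> for eigenvalues
  other than \<open>e\<close> can be divided by \<open>f - e\<close> and removed from \<open>v\<close>; the remainder is annihilated by
  \<open>(B - e)\<^sup>2\<close>, hence by \<open>B - e\<close>, and is itself an eigenvector.\<close>

lemma splits_into_eigenvectors_lift:
  fixes A :: "real Matrix.mat" and e :: complex
  assumes A: "A \<in> carrier_mat n n" and sym: "transpose_mat A = A"
    and v: "v \<in> carrier_vec n"
  defines "B \<equiv> map_mat complex_of_real A"
  assumes split: "splits_into_eigenvectors B (B *\<^sub>v v - e \<cdot>\<^sub>v v)"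
  shows "splits_into_eigenvectors B v"
proof -
  have B: "B \<in> carrier_mat n n" using A by (simp add: B_def)
  have dim: "dim_vec (B *\<^sub>v v - e \<cdot>\<^sub>v v) = n" using v by simp
  obtain E :: "real set" and w where E: "finite E"
    and wE: "\<And>f. f \<in> E \<Longrightarrow> w f \<in> carrier_vec n"
    and Bw: "\<And>f. f \<in> E \<Longrightarrow> B *\<^sub>v w f = complex_of_real f \<cdot>\<^sub>v w f"
    and sum: "\<And>i. i < n \<Longrightarrow> (B *\<^sub>v v - e \<cdot>\<^sub>v v) $ i = (\<Sum>f\<in>E. w f $ i)"
    using split unfolding splits_into_eigenvectors_def dim by blast
  define E' where "E' = {f\<in>E. complex_of_real f \<noteq> e}"
  define c where "c f = inverse (complex_of_real f - e)" for f :: real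
  define r where "r = Matrix.vec n (\<lambda>i. v $ i - (\<Sum>f\<in>E'. c f * w f $ i))"
  have r: "r \<in> carrier_vec n" by (simp add: r_def)
  have E': "finite E'" "E' \<subseteq> E" using E by (auto simp: E'_def)
  have Bi: "(B *\<^sub>v x) $ i = (\<Sum>j<n. B $$ (i, j) * x $ j)" if "x \<in> carrier_vec n" "i < n" for x i
    using that B by (auto simp: scalar_prod_def atLeast0LessThan)
  have Bwi: "(\<Sum>j<n. B $$ (i, j) * w f $ j) = complex_of_real f * w f $ i" if "f \<in> E" "i < n" for f i
    using that Bi[OF wE[OF that(1)] that(2)] Bw[OF that(1)] wE[OF that(1)] by simp
  \<comment> \<open>For an eigenvalue f other than e, the vector w f is (B - e) applied to its
      multiple by 1 / (f - e), so subtracting these multiples from v leaves only the e-part of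
      (B - e) v.\<close>
  have rest: "(B *\<^sub>v r - e \<cdot>\<^sub>v r) $ i = (\<Sum>f\<in>E - E'. w f $ i)" if i: "i < n" for i
  proof -
    have "(B *\<^sub>v r) $ i = (\<Sum>j<n. B $$ (i, j) * (v $ j - (\<Sum>f\<in>E'. c f * w f $ j)))"
      by (subst Bi[OF r i]) (simp add: r_def)
    also have "\<dots> = (B *\<^sub>v v) $ i - (\<Sum>j<n. \<Sum>f\<in>E'. c f * (B $$ (i, j) * w f $ j))"
      by (simp add: Bi[OF v i] algebra_simps sum_subtractf sum_distrib_left)
    also have "(\<Sum>j<n. \<Sum>f\<in>E'. c f * (B $$ (i, j) * w f $ j))
        = (\<Sum>f\<in>E'. c f * (\<Sum>j<n. B $$ (i, j) * w f $ j))"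
      by (subst sum.swap) (simp add: sum_distrib_left)
    also have "\<dots> = (\<Sum>f\<in>E'. c f * (complex_of_real f * w f $ i))"
      using E' i by (intro sum.cong refl arg_cong2[of _ _ _ _ "(*)"] Bwi) auto
    finally have "(B *\<^sub>v r - e \<cdot>\<^sub>v r) $ i
        = (B *\<^sub>v v - e \<cdot>\<^sub>v v) $ i
          - (\<Sum>f\<in>E'. c f * (complex_of_real f * w f $ i) - e * (c f * w f $ i))"
      using i v r B by (simp add: r_def algebra_simps sum_subtractf sum_distrib_left)
    also have "(\<Sum>f\<in>E'. c f * (complex_of_real f * w f $ i) - e * (c f * w f $ i))
        = (\<Sum>f\<in>E'. w f $ i)"
    proof (rule sum.cong[OF refl])
      fix f assume "f \<in> E'"
      then have "c f * (complex_of_real f - e) = 1" by (auto simp: E'_def c_def)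
      then have "c f * (complex_of_real f - e) * w f $ i = w f $ i" by simp
      then show "c f * (complex_of_real f * w f $ i) - e * (c f * w f $ i) = w f $ i"
        by (simp add: algebra_simps)
    qed
    finally show ?thesis
      using sum[OF i] E E' by (simp add: sum_diff)
  qed
  define s where "s = B *\<^sub>v r - e \<cdot>\<^sub>v r"
  have s: "s \<in> carrier_vec n" using r B by (simp add: s_def)
  have si: "s $ i = (\<Sum>f\<in>E - E'. w f $ i)" if "i < n" for i
    using rest[OF that] by (simp only: s_def)
  have "B *\<^sub>v s = e \<cdot>\<^sub>v s"
  proof (rule eq_vecI)
    show "dim_vec (B *\<^sub>v s) = dim_vec (e \<cdot>\<^sub>v s)" using B s by simp
    fix i assume "i < dim_vec (e \<cdot>\<^sub>v s)"
    then have i: "i < n" using s by simp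
    have "(B *\<^sub>v s) $ i = (\<Sum>j<n. \<Sum>f\<in>E - E'. B $$ (i, j) * w f $ j)"
      by (simp add: Bi[OF s i] si sum_distrib_left)
    also have "\<dots> = (\<Sum>f\<in>E - E'. e * w f $ i)"
      using i by (subst sum.swap) (auto intro!: sum.cong simp: Bwi E'_def)
    finally show "(B *\<^sub>v s) $ i = (e \<cdot>\<^sub>v s) $ i"
      using i s by (simp add: si sum_distrib_left)
  qed
  then have s0: "s = 0\<^sub>v n"
    using hermitian_no_generalized_eigenvector[OF A sym r, folded B_def] s_def by blast
  have Br: "B *\<^sub>v r = e \<cdot>\<^sub>v r"
  proof (rule eq_vecI)
    fix i assume "i < dim_vec (e \<cdot>\<^sub>v r)"
    then have "i < n" using r by simp
    then have "s $ i = 0" using s0 by simp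
    then show "(B *\<^sub>v r) $ i = (e \<cdot>\<^sub>v r) $ i"
      using \<open>i < n\<close> r B by (simp add: s_def)
  qed (use B r in simp)
  have vi: "v $ i = r $ i + (\<Sum>f\<in>E'. (c f \<cdot>\<^sub>v w f) $ i)" if "i < n" for i
    using that v E' wE by (auto simp: r_def intro!: sum.cong) (smt (verit) carrier_vecD index_smult_vec(1) subsetD sum.cong)
  have Bcw: "B *\<^sub>v (c f \<cdot>\<^sub>v w f) = complex_of_real f \<cdot>\<^sub>v (c f \<cdot>\<^sub>v w f)" if "f \<in> E'" for f
    using that E' wE Bw B by (subst mult_mat_vec[OF B]) (auto simp: smult_smult_assoc mult.commute)
  show ?thesis
  proof (cases "e \<in> \<real>")
    case True
    then obtain g where g: "e = complex_of_real g" by (auto elim: Reals_cases)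
    have gE: "g \<notin> E'" by (simp add: E'_def g)
    let ?w = "(\<lambda>f. c f \<cdot>\<^sub>v w f)(g := r)"
    have "(\<Sum>f\<in>insert g E'. ?w f $ i) = r $ i + (\<Sum>f\<in>E'. (c f \<cdot>\<^sub>v w f) $ i)" for i
    proof -
      have "(\<Sum>f\<in>E'. ?w f $ i) = (\<Sum>f\<in>E'. (c f \<cdot>\<^sub>v w f) $ i)"
        using gE by (intro sum.cong) auto
      then show ?thesis using E' gE by simp
    qed
    then show ?thesis
      unfolding splits_into_eigenvectors_def
      using E' gE wE r Bcw Br g vi v
      by (intro exI[of _ "insert g E'"] exI[of _ ?w]) auto
  next
    case False
    \<comment> \<open>Then e is no eigenvalue, so the remainder vanishes.\<close>
    have "e * (r \<bullet>c r) = (B *\<^sub>v r) \<bullet>c r" using r Br by simp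
    also have "\<dots> = r \<bullet>c (e \<cdot>\<^sub>v r)" using hermitian_adjoint[OF A sym r r, folded B_def] Br by simp
    also have "\<dots> = cnj e * (r \<bullet>c r)" using r by (simp add: conjugate_smult_vec)
    finally have "r \<bullet>c r = 0" using False by (auto simp: Reals_cnj_iff)
    then have "r = 0\<^sub>v n" using conjugate_square_eq_0_vec[OF r] by simp
    then show ?thesis
      unfolding splits_into_eigenvectors_def
      using E' wE Bcw vi v
      by (intro exI[of _ E'] exI[of _ "\<lambda>f. c f \<cdot>\<^sub>v w f"]) auto
  qed
qed

text \<open>Triangularize \<open>B = P T Q\<close>. If \<open>c\<close> is supported on the first \<open>k + 1\<close> coordinates, then
  \<open>(T - T $$ (k, k)) c\<close> is supported on the first \<open>k\<close>, so induction on the support of \<open>c\<close>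
  decomposes every vector \<open>P c\<close>.\<close>

lemma splits_into_eigenvectors_symmetric:
  fixes A :: "real Matrix.mat"
  assumes A: "A \<in> carrier_mat n n" and sym: "transpose_mat A = A"
    and v: "v \<in> carrier_vec n"
  shows "splits_into_eigenvectors (map_mat complex_of_real A) v"
proof -
  define B where "B = map_mat complex_of_real A"
  have B: "B \<in> carrier_mat n n" using A by (simp add: B_def)
  obtain as where "char_poly B = (\<Prod>a\<leftarrow>as. [:- a, 1:])"
    using char_poly_factorized[OF B] by blast
  then obtain T P Q where T: "upper_triangular T" and wit: "similar_mat_wit B T P Q"
    using schur_decomposition_exists[OF B] unfolding similar_mat_def by blast
  note w = similar_mat_witD2[OF B wit]
  have main: "splits_into_eigenvectors B (P *\<^sub>v c)"
    if "k \<le> n" "c \<in> carrier_vec n" "\<And>j. j < n \<Longrightarrow> k \<le> j \<Longrightarrow> c $ j = 0" for k c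
    using that
  proof (induction k arbitrary: c)
    case 0
    then have "c = 0\<^sub>v n" by (intro eq_vecI) auto
    then have "P *\<^sub>v c = 0\<^sub>v n" using w(6) by (intro eq_vecI) auto
    then show ?case
      unfolding splits_into_eigenvectors_def by (intro exI[of _ "{}"]) auto
  next
    case (Suc k)
    have c: "c \<in> carrier_vec n" and k: "k < n" using Suc.prems by auto
    let ?d = "T *\<^sub>v c - T $$ (k, k) \<cdot>\<^sub>v c"
    have d: "?d \<in> carrier_vec n" using w c by auto
    have "?d $ j = 0" if j: "j < n" "k \<le> j" for j
    proof -
      have "(T *\<^sub>v c) $ j = (\<Sum>i<n. T $$ (j, i) * c $ i)"
        using w(5) c j by (auto simp: scalar_prod_def atLeast0LessThan)
      also have "\<dots> = (\<Sum>i<n. if i = k then T $$ (j, k) * c $ k else 0)"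
      proof (rule sum.cong[OF refl])
        fix i assume i: "i \<in> {..<n}"
        consider "i < k" | "i = k" | "k < i" by linarith
        then show "T $$ (j, i) * c $ i = (if i = k then T $$ (j, k) * c $ k else 0)"
        proof cases
          case 1 then have "T $$ (j, i) = 0" using upper_triangularD[OF T, of i j] j w(5) by simp
          then show ?thesis using 1 by simp
        next
          case 3 then have "c $ i = 0" using Suc.prems(3)[of i] i by simp
          then show ?thesis using 3 by simp
        qed simp
      qed
      also have "\<dots> = T $$ (j, k) * c $ k" using k by simp
      finally have Tc: "(T *\<^sub>v c) $ j = T $$ (j, k) * c $ k" .
      show ?thesis
      proof (cases "j = k")
        case True then show ?thesis using Tc j c w(5) by simp
      next
        case False
        then have "T $$ (j, k) = 0" "c $ j = 0"
          using upper_triangularD[OF T, of k j] j w(5) Suc.prems(3)[of j] by auto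
        then show ?thesis using Tc j c w(5) by simp
      qed
    qed
    then have "splits_into_eigenvectors B (P *\<^sub>v ?d)" using Suc.IH[OF _ d] k by auto
    moreover have "P *\<^sub>v ?d = B *\<^sub>v (P *\<^sub>v c) - T $$ (k, k) \<cdot>\<^sub>v (P *\<^sub>v c)"
    proof -
      have "B *\<^sub>v (P *\<^sub>v c) = (P * T * Q) *\<^sub>v (P *\<^sub>v c)" using w(3) by simp
      also have "\<dots> = P *\<^sub>v (T *\<^sub>v ((Q * P) *\<^sub>v c))"
        using w(5,6,7) c by (simp add: assoc_mult_mat_vec[of _ n n _ n])
      also have "\<dots> = P *\<^sub>v (T *\<^sub>v c)" using w(2) c by simp
      finally show ?thesis
        using w(5,6) c by (simp add: mult_minus_distrib_mat_vec[of P n n] mult_mat_vec[of P n n])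
    qed
    ultimately show ?case
      using splits_into_eigenvectors_lift[OF A sym, of "P *\<^sub>v c", folded B_def] w(6) c by auto
  qed
  have "P *\<^sub>v (Q *\<^sub>v v) = (P * Q) *\<^sub>v v" using w(6,7) v by simp
  then have "v = P *\<^sub>v (Q *\<^sub>v v)" using w(1) v by simp
  then show ?thesis using main[of n "Q *\<^sub>v v"] w(7) v B_def by auto
qed

text \<open>The eigenvalues being real, the real parts of complex eigenvectors are again eigenvectors.\<close>

lemma symmetric_eigenvector_sum:
  fixes A :: "real Matrix.mat"
  assumes A: "A \<in> carrier_mat n n" and sym: "transpose_mat A = A" and v: "v \<in> carrier_vec n"
  obtains E w where "finite E" "\<And>e. e \<in> E \<Longrightarrow> w e \<in> carrier_vec n"
    "\<And>e. e \<in> E \<Longrightarrow> A *\<^sub>v w e = e \<cdot>\<^sub>v w e" "\<And>i. i < n \<Longrightarrow> v $ i = (\<Sum>e\<in>E. w e $ i)"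
proof -
  let ?v = "map_vec complex_of_real v"
  have v': "?v \<in> carrier_vec n" and dim: "dim_vec ?v = n" using v by auto
  obtain E w where E: "finite E"
    and wE: "\<And>f. f \<in> E \<Longrightarrow> w f \<in> carrier_vec n"
    and Bw: "\<And>f. f \<in> E \<Longrightarrow> map_mat complex_of_real A *\<^sub>v w f = complex_of_real f \<cdot>\<^sub>v w f"
    and sum: "\<And>i. i < n \<Longrightarrow> ?v $ i = (\<Sum>f\<in>E. w f $ i)"
    using splits_into_eigenvectors_symmetric[OF A sym v']
    unfolding splits_into_eigenvectors_def dim by blast
  show ?thesis
  proof (rule that[of E "\<lambda>e. map_vec Re (w e)"])
    show "finite E" by fact
    show "map_vec Re (w e) \<in> carrier_vec n" if "e \<in> E" for e using wE[OF that] by simp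
    show "v $ i = (\<Sum>e\<in>E. map_vec Re (w e) $ i)" if "i < n" for i
    proof -
      have "v $ i = Re (?v $ i)" using that v by simp
      also have "\<dots> = (\<Sum>f\<in>E. Re (w f $ i))" by (simp only: sum[OF that] Re_sum)
      also have "\<dots> = (\<Sum>e\<in>E. map_vec Re (w e) $ i)"
        using that wE by (intro sum.cong) (auto dest!: wE)
      finally show ?thesis .
    qed
    show "A *\<^sub>v map_vec Re (w e) = e \<cdot>\<^sub>v map_vec Re (w e)" if e: "e \<in> E" for e
    proof (rule eq_vecI)
      show "dim_vec (A *\<^sub>v map_vec Re (w e)) = dim_vec (e \<cdot>\<^sub>v map_vec Re (w e))"
        using A wE[OF e] by simp
      fix i assume "i < dim_vec (e \<cdot>\<^sub>v map_vec Re (w e))"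
      then have i: "i < n" using wE[OF e] by simp
      have "(A *\<^sub>v map_vec Re (w e)) $ i = Re ((map_mat complex_of_real A *\<^sub>v w e) $ i)"
        using A wE[OF e] i by (simp add: scalar_prod_def)
      then show "(A *\<^sub>v map_vec Re (w e)) $ i = (e \<cdot>\<^sub>v map_vec Re (w e)) $ i"
        using Bw[OF e] i wE[OF e] by simp
    qed
  qed
qed

lemma symmetric_scalar_prod:
  fixes A :: "real Matrix.mat"
  assumes A: "A \<in> carrier_mat n n" and sym: "transpose_mat A = A"
    and u: "u \<in> carrier_vec n" and v: "v \<in> carrier_vec n"
  shows "u \<bullet> (A *\<^sub>v v) = (A *\<^sub>v u) \<bullet> v"
  using transpose_vec_mult_scalar[OF A v u] sym by simp

text \<open>Together with the next lemma this is a functional calculus: a vector is represented by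
  coefficients on eigenvectors, \<open>A\<close> multiplies each coefficient by its eigenvalue, and scalar
  products are diagonal.\<close>

lemma eigenvector_sum_image:
  fixes A :: "real Matrix.mat"
  assumes A: "A \<in> carrier_mat n n"
    and wE: "\<And>e. e \<in> E \<Longrightarrow> w e \<in> carrier_vec n"
    and Aw: "\<And>e. e \<in> E \<Longrightarrow> A *\<^sub>v w e = e \<cdot>\<^sub>v w e"
  shows "A *\<^sub>v Matrix.vec n (\<lambda>i. \<Sum>e\<in>E. a e * w e $ i)
       = Matrix.vec n (\<lambda>i. \<Sum>e\<in>E. (a e * e) * w e $ i)"
proof (rule eq_vecI)
  fix i assume "i < dim_vec (Matrix.vec n (\<lambda>i. \<Sum>e\<in>E. (a e * e) * w e $ i))"
  then have i: "i < n" by simp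
  have Awi: "(\<Sum>j<n. A $$ (i, j) * w e $ j) = e * w e $ i" if "e \<in> E" for e
  proof -
    have "(A *\<^sub>v w e) $ i = (\<Sum>j<n. A $$ (i, j) * w e $ j)"
      using A i wE[OF that] by (auto simp: scalar_prod_def atLeast0LessThan)
    then show ?thesis using Aw[OF that] i wE[OF that] by simp
  qed
  have "(A *\<^sub>v Matrix.vec n (\<lambda>i. \<Sum>e\<in>E. a e * w e $ i)) $ i
      = (\<Sum>j<n. \<Sum>e\<in>E. a e * (A $$ (i, j) * w e $ j))"
    using A i by (simp add: scalar_prod_def atLeast0LessThan sum_distrib_left algebra_simps)
  also have "\<dots> = (\<Sum>e\<in>E. a e * (\<Sum>j<n. A $$ (i, j) * w e $ j))"
    by (subst sum.swap) (simp add: sum_distrib_left)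
  also have "\<dots> = (\<Sum>e\<in>E. (a e * e) * w e $ i)"
    by (intro sum.cong refl) (simp add: Awi)
  finally show "(A *\<^sub>v Matrix.vec n (\<lambda>i. \<Sum>e\<in>E. a e * w e $ i)) $ i
      = Matrix.vec n (\<lambda>i. \<Sum>e\<in>E. (a e * e) * w e $ i) $ i" using i by simp
qed (use A in simp)

lemma eigenvector_sum_scalar_prod:
  fixes A :: "real Matrix.mat"
  assumes A: "A \<in> carrier_mat n n" and sym: "transpose_mat A = A" and E: "finite E"
    and wE: "\<And>e. e \<in> E \<Longrightarrow> w e \<in> carrier_vec n"
    and Aw: "\<And>e. e \<in> E \<Longrightarrow> A *\<^sub>v w e = e \<cdot>\<^sub>v w e"
  shows "Matrix.vec n (\<lambda>i. \<Sum>e\<in>E. a e * w e $ i) \<bullet> Matrix.vec n (\<lambda>i. \<Sum>e\<in>E. b e * w e $ i)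
       = (\<Sum>e\<in>E. a e * b e * (w e \<bullet> w e))"
proof -
  have orth: "w e \<bullet> w f = 0" if "e \<in> E" "f \<in> E" "e \<noteq> f" for e f
  proof -
    have "f * (w e \<bullet> w f) = w e \<bullet> (A *\<^sub>v w f)"
      using Aw wE[OF that(1)] wE[OF that(2)] that by simp
    also have "\<dots> = (A *\<^sub>v w e) \<bullet> w f" using that by (intro symmetric_scalar_prod[OF A sym] wE)
    also have "\<dots> = e * (w e \<bullet> w f)"
      using Aw wE[OF that(1)] wE[OF that(2)] that by simp
    finally show ?thesis using that by simp
  qed
  have wf: "w e \<bullet> w f = (\<Sum>i<n. w e $ i * w f $ i)" if "e \<in> E" "f \<in> E" for e f
    using wE[OF that(2)] by (auto simp: scalar_prod_def atLeast0LessThan)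
  have "Matrix.vec n (\<lambda>i. \<Sum>e\<in>E. a e * w e $ i) \<bullet> Matrix.vec n (\<lambda>i. \<Sum>e\<in>E. b e * w e $ i)
      = (\<Sum>i<n. \<Sum>e\<in>E. \<Sum>f\<in>E. a e * b f * (w e $ i * w f $ i))"
    by (simp add: scalar_prod_def atLeast0LessThan sum_product algebra_simps)
  also have "\<dots> = (\<Sum>e\<in>E. \<Sum>f\<in>E. a e * b f * (\<Sum>i<n. w e $ i * w f $ i))"
    by (subst sum.swap, rule sum.cong[OF refl], subst sum.swap) (simp add: sum_distrib_left)
  also have "\<dots> = (\<Sum>e\<in>E. \<Sum>f\<in>E. if f = e then a e * b e * (w e \<bullet> w e) else 0)"
    by (intro sum.cong refl) (auto simp flip: wf simp: orth)
  finally show ?thesis using E by simp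
qed

text \<open>Divide each eigencomponent of \<open>v\<close> with a non-zero eigenvalue by that eigenvalue. The ranges
  of \<open>A\<close> and \<open>A\<^sup>2\<close> therefore agree, which is what provides the pseudoinverse below.\<close>

lemma symmetric_range_square:
  fixes A :: "real Matrix.mat"
  assumes A: "A \<in> carrier_mat n n" and sym: "transpose_mat A = A" and v: "v \<in> carrier_vec n"
  shows "\<exists>x \<in> carrier_vec n. A *\<^sub>v v = A *\<^sub>v (A *\<^sub>v x)"
proof -
  obtain E w where E: "finite E" "\<And>e. e \<in> E \<Longrightarrow> w e \<in> carrier_vec n"
    "\<And>e. e \<in> E \<Longrightarrow> A *\<^sub>v w e = e \<cdot>\<^sub>v w e" "\<And>i. i < n \<Longrightarrow> v $ i = (\<Sum>e\<in>E. w e $ i)"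
    using symmetric_eigenvector_sum[OF A sym v] by metis
  note image = eigenvector_sum_image[OF A E(2,3)]
  have "v = Matrix.vec n (\<lambda>i. \<Sum>e\<in>E. 1 * w e $ i)" using E(4) v by (intro eq_vecI) auto
  then have 1: "A *\<^sub>v v = Matrix.vec n (\<lambda>i. \<Sum>e\<in>E. 1 * e * w e $ i)"
    by (rule ssubst) (rule image)
  let ?x = "Matrix.vec n (\<lambda>i. \<Sum>e\<in>E. inverse e * w e $ i)"
  \<comment> \<open>As inverse 0 is 0, the kernel part of v contributes nothing to the preimage.\<close>
  have "A *\<^sub>v (A *\<^sub>v ?x) = Matrix.vec n (\<lambda>i. \<Sum>e\<in>E. inverse e * e * e * w e $ i)"
    by (simp only: image)
  also have "\<dots> = A *\<^sub>v v"
    unfolding 1 by (intro arg_cong2[of _ _ _ _ Matrix.vec] ext sum.cong refl) (auto simp: field_simps)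
  finally show ?thesis by (intro bexI[of _ ?x]) auto
qed

text \<open>In eigencoordinates the claim compares \<open>\<lambda> e\<close> with \<open>e\<^sup>2\<close> for every eigenvalue \<open>e\<close>: both
  vanish for \<open>e = 0\<close>, and otherwise \<open>e\<close> is positive by semidefiniteness and at
  least \<open>\<lambda>\<close> by minimality.\<close>

lemma rayleigh_lambda_min_pos:
  assumes A: "A \<in> carrier_mat n n" and psd: "psd_mat A" and u: "u \<in> carrier_vec n"
  shows "lambda_min_pos A * (u \<bullet> (A *\<^sub>v u)) \<le> (A *\<^sub>v u) \<bullet> (A *\<^sub>v u)"
proof -
  have sym: "transpose_mat A = A" and nonneg: "\<And>v. v \<in> carrier_vec n \<Longrightarrow> 0 \<le> v \<bullet> (A *\<^sub>v v)"
    using psd A by (auto simp: psd_mat_def)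
  obtain E w where E: "finite E" "\<And>e. e \<in> E \<Longrightarrow> w e \<in> carrier_vec n"
    "\<And>e. e \<in> E \<Longrightarrow> A *\<^sub>v w e = e \<cdot>\<^sub>v w e" "\<And>i. i < n \<Longrightarrow> u $ i = (\<Sum>e\<in>E. w e $ i)"
    using symmetric_eigenvector_sum[OF A sym u] by metis
  note image = eigenvector_sum_image[OF A E(2,3)]
  note prod = eigenvector_sum_scalar_prod[OF A sym E(1,2,3)]
  have u1: "u = Matrix.vec n (\<lambda>i. \<Sum>e\<in>E. 1 * w e $ i)" using E(4) u by (intro eq_vecI) auto
  have Au: "A *\<^sub>v u = Matrix.vec n (\<lambda>i. \<Sum>e\<in>E. 1 * e * w e $ i)"
    by (subst u1) (rule image)
  have uAu: "u \<bullet> (A *\<^sub>v u) = (\<Sum>e\<in>E. 1 * (1 * e) * (w e \<bullet> w e))"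
    unfolding Au by (subst u1, subst prod) auto
  have AuAu: "(A *\<^sub>v u) \<bullet> (A *\<^sub>v u) = (\<Sum>e\<in>E. (1 * e) * (1 * e) * (w e \<bullet> w e))"
    unfolding Au by (subst prod) auto
  have le: "lambda_min_pos A * (e * (w e \<bullet> w e)) \<le> e * (e * (w e \<bullet> w e))" if e: "e \<in> E" for e
  proof (cases "e = 0 \<or> w e = 0\<^sub>v n")
    case False
    have "eigenvector A (w e) e" using False A E e by (simp add: eigenvector_def)
    then have ev: "eigenvalue A e" by (auto simp: eigenvalue_def)
    have "finite {e. eigenvalue A e}"
      using card_finite_spectrum(1)[OF A] by (simp add: spectrum_def)
    then have "lambda_min_pos A \<le> e"
      unfolding lambda_min_pos_def using ev False by (intro Min_le) auto
    moreover have "0 \<le> e * (w e \<bullet> w e)" using nonneg[of "w e"] E e by simp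
    ultimately show ?thesis by (rule mult_right_mono)
  qed auto
  show ?thesis
    unfolding uAu AuAu sum_distrib_left using le by (intro sum_mono) (simp add: mult.assoc)
qed

section \<open>The pseudoinverse of a symmetric matrix\<close>

definition penrose_inverse :: "real Matrix.mat \<Rightarrow> real Matrix.mat \<Rightarrow> bool" where
  "penrose_inverse M P \<longleftrightarrow> P \<in> carrier_mat (dim_col M) (dim_row M) \<and>
     M * P * M = M \<and> P * M * P = P \<and>
     transpose_mat (M * P) = M * P \<and> transpose_mat (P * M) = P * M"

text \<open>Penrose's argument: \<open>M P\<close> and \<open>M Q\<close> are symmetric idempotents that absorb each other, hence
  equal, and so are \<open>P M\<close> and \<open>Q M\<close>.\<close>

lemma penrose_inverse_unique:
  assumes P: "penrose_inverse M P" and Q: "penrose_inverse M Q"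
  shows "P = Q"
proof -
  define m n where "m = dim_row M" and "n = dim_col M"
  have c: "M \<in> carrier_mat m n" "P \<in> carrier_mat n m" "Q \<in> carrier_mat n m"
    using P Q by (auto simp: penrose_inverse_def m_def n_def)
  note p = P[unfolded penrose_inverse_def] and q = Q[unfolded penrose_inverse_def]
  note assoc = assoc_mult_mat[of _ m n _ m _ m] assoc_mult_mat[of _ m n _ m _ n]
    assoc_mult_mat[of _ m n _ n _ m] assoc_mult_mat[of _ m m _ n _ m]
    assoc_mult_mat[of _ n m _ n _ n] assoc_mult_mat[of _ n m _ n _ m]
    assoc_mult_mat[of _ n m _ m _ n] assoc_mult_mat[of _ n n _ m _ n]
  have MM: "(M * Q) * (M * P) = M * P" "(M * P) * (M * Q) = M * Q"
    "(P * M) * (Q * M) = P * M" "(Q * M) * (P * M) = Q * M"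
  proof -
    have "(M * Q) * (M * P) = (M * Q * M) * P" using c by (simp add: assoc)
    then show "(M * Q) * (M * P) = M * P" using q by simp
    have "(M * P) * (M * Q) = (M * P * M) * Q" using c by (simp add: assoc)
    then show "(M * P) * (M * Q) = M * Q" using p by simp
    have "(P * M) * (Q * M) = P * (M * Q * M)" using c by (simp add: assoc)
    then show "(P * M) * (Q * M) = P * M" using q by simp
    have "(Q * M) * (P * M) = Q * (M * P * M)" using c by (simp add: assoc)
    then show "(Q * M) * (P * M) = Q * M" using p by simp
  qed
  have "M * P = transpose_mat ((M * Q) * (M * P))" using MM p by simp
  also have "\<dots> = (M * P) * (M * Q)"
    using p q c by (subst transpose_mult[of _ m m _ m]) auto
  finally have MPQ: "M * P = M * Q" using MM by simp
  have "P * M = transpose_mat ((P * M) * (Q * M))" using MM p by simp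
  also have "\<dots> = (Q * M) * (P * M)"
    using p q c by (subst transpose_mult[of _ n n _ n]) auto
  finally have PQM: "P * M = Q * M" using MM by simp
  have "P = P * (M * P)" using p c by (simp add: assoc_mult_mat[of _ n m _ n _ m])
  also have "\<dots> = (P * M) * Q" using c MPQ by (simp add: assoc_mult_mat[of _ n m _ n _ m])
  also have "\<dots> = Q" using PQM q by simp
  finally show ?thesis .
qed

text \<open>Since the ranges of \<open>B\<close> and \<open>B\<^sup>2\<close> agree, \<open>B = B B W\<close> for some \<open>W\<close>, and by transposition
  \<open>B = W\<^sup>T B B\<close>. Then \<open>B W = W\<^sup>T B\<close> is the orthogonal projection onto the range, and
  \<open>W\<^sup>T B W\<close> is the pseudoinverse.\<close>

lemma penrose_inverse_symmetric_exists:
  assumes B: "B \<in> carrier_mat n n" and sym: "transpose_mat B = B"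
  shows "\<exists>P. penrose_inverse B P"
proof -
  have "\<exists>x. x \<in> carrier_vec n \<and> B *\<^sub>v unit_vec n j = B *\<^sub>v (B *\<^sub>v x)" for j
    using symmetric_range_square[OF B sym, of "unit_vec n j"] by auto
  then obtain x where x: "\<And>j. x j \<in> carrier_vec n"
    "\<And>j. B *\<^sub>v unit_vec n j = B *\<^sub>v (B *\<^sub>v x j)" by metis
  define W where "W = mat_of_cols n (map x [0..<n])"
  have W: "W \<in> carrier_mat n n" by (simp add: W_def mat_of_cols_carrier(1)[of n "map x [0..<n]", simplified])
  note [simp] = assoc_mult_mat[of _ n n _ n _ n]
  have colW: "col W j = x j" if "j < n" for j
    unfolding W_def using that x by (subst col_mat_of_cols) auto
  have BBW: "B * (B * W) = B"
  proof (rule mat_col_eqI)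
    fix j assume "j < dim_col B"
    then have j: "j < n" using B by simp
    have "col (B * (B * W)) j = B *\<^sub>v (B *\<^sub>v x j)"
      using col_mult2[OF B, of "B * W" n j] col_mult2[OF B W j] B W j by (simp add: colW)
    also have "\<dots> = B *\<^sub>v unit_vec n j" using x by simp
    also have "\<dots> = col B j" using B j by (intro eq_vecI) auto
    finally show "col (B * (B * W)) j = col B j" .
  qed (use B W in auto)
  define V where "V = transpose_mat W"
  have V: "V \<in> carrier_mat n n" using W by (simp add: V_def)
  have VBB: "V * (B * B) = B"
  proof -
    have "transpose_mat (B * (B * W)) = B" using BBW sym by simp
    then show ?thesis using B W V sym by (simp add: transpose_mult[of _ n n _ n] V_def)
  qed
  have BW: "B * W = V * B"
  proof -
    have "B * W = (V * (B * B)) * W" using VBB by simp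
    also have "\<dots> = V * (B * (B * W))" using B V W by simp
    finally show ?thesis using BBW by simp
  qed
  define P where "P = V * (B * W)"
  have P: "P \<in> carrier_mat n n" using V B W by (simp add: P_def)
  have symP: "transpose_mat P = P"
    using B V W sym by (simp add: P_def V_def transpose_mult[of _ n n _ n])
  have BP: "B * P = B * W"
  proof -
    have "P = (V * B) * W" using assoc_mult_mat[OF V B W] by (simp add: P_def)
    also have "\<dots> = (B * W) * W" by (simp only: BW)
    finally have "B * P = (B * (B * W)) * W" using B W by simp
    then show ?thesis using BBW by simp
  qed
  have symBW: "transpose_mat (B * W) = B * W"
    using B V W sym BW by (simp add: V_def transpose_mult[of _ n n _ n])
  have PB: "P * B = B * W"
  proof -
    have "P * B = transpose_mat (B * P)" using B P sym symP by (simp add: transpose_mult[of _ n n _ n])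
    then show ?thesis using BP symBW by simp
  qed
  have "B * P * B = B * W * B" using BP by simp
  also have "\<dots> = V * (B * B)" using BW B V by simp
  finally have BPB: "B * P * B = B" using VBB by simp
  have "P * B * P = (B * W) * (V * (B * W))" using PB by (simp add: P_def)
  also have "\<dots> = V * (B * (B * W)) * W" using B V W BW by simp
  also have "\<dots> = P" using BBW B V W by (simp add: P_def)
  finally have PBP: "P * B * P = P" .
  show ?thesis
    using B P BPB PBP PB BP symBW by (intro exI[of _ P]) (auto simp: penrose_inverse_def)
qed

lemma pinv_symmetric:
  assumes B: "B \<in> carrier_mat n n" and sym: "transpose_mat B = B"
  shows "pinv B \<in> carrier_mat n n" "B * pinv B * B = B"
    "transpose_mat (B * pinv B) = B * pinv B" "transpose_mat (pinv B) = pinv B"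
proof -
  have "\<exists>!P. penrose_inverse B P"
    using penrose_inverse_symmetric_exists[OF B sym] penrose_inverse_unique by blast
  then have P: "penrose_inverse B (pinv B)"
    unfolding pinv_def penrose_inverse_def by (rule theI')
  then show c: "pinv B \<in> carrier_mat n n" and 1: "B * pinv B * B = B"
    "transpose_mat (B * pinv B) = B * pinv B"
    using B by (auto simp: penrose_inverse_def)
  note tm = transpose_mult[of _ n n _ n] and am = assoc_mult_mat[of _ n n _ n _ n]
  note p = P[unfolded penrose_inverse_def]
  \<comment> \<open>Transposition permutes the four Penrose conditions of a symmetric matrix.\<close>
  have "penrose_inverse B (transpose_mat (pinv B))"
    unfolding penrose_inverse_def
  proof (intro conjI)
    show "transpose_mat (pinv B) \<in> carrier_mat (dim_col B) (dim_row B)" using B c by simp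
    have "transpose_mat (B * pinv B * B) = B" using 1 sym by simp
    then show "B * transpose_mat (pinv B) * B = B" using B c sym by (simp add: tm am)
    have "transpose_mat (pinv B * B * pinv B) = transpose_mat (pinv B)" using p by simp
    then show "transpose_mat (pinv B) * B * transpose_mat (pinv B) = transpose_mat (pinv B)"
      using B c sym by (simp add: tm am)
    have "transpose_mat (transpose_mat (pinv B * B)) = transpose_mat (pinv B * B)" using p by simp
    then show "transpose_mat (B * transpose_mat (pinv B)) = B * transpose_mat (pinv B)"
      using B c sym by (simp add: tm)
    have "transpose_mat (transpose_mat (B * pinv B)) = transpose_mat (B * pinv B)" using p by simp
    then show "transpose_mat (transpose_mat (pinv B) * B) = transpose_mat (pinv B) * B"
      using B c sym by (simp add: tm)
  qed
  then show "transpose_mat (pinv B) = pinv B" using P penrose_inverse_unique by blast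
qed

section \<open>Quadratic forms of positive semidefinite matrices\<close>

lemma psd_matD:
  assumes "A \<in> carrier_mat n n" "psd_mat A"
  shows "transpose_mat A = A" "\<And>v. v \<in> carrier_vec n \<Longrightarrow> 0 \<le> v \<bullet> (A *\<^sub>v v)"
  using assms by (auto simp: psd_mat_def)

lemma real_scalar_prod_self_eq_0:
  fixes v :: "real Matrix.vec"
  assumes v: "v \<in> carrier_vec n" and 0: "v \<bullet> v = 0"
  shows "v = 0\<^sub>v n"
proof (rule eq_vecI)
  fix i assume "i < dim_vec (0\<^sub>v n :: real Matrix.vec)"
  then have i: "i \<in> {0..<n}" by simp
  have "(\<Sum>j\<in>{0..<n}. v $ j * v $ j) = 0" using 0 v by (simp add: scalar_prod_def)
  then have "v $ i * v $ i = 0" using i by (simp add: sum_nonneg_eq_0_iff)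
  then show "v $ i = 0\<^sub>v n $ i" using i by simp
qed (use v in simp)

lemma quadratic_form_add:
  fixes A :: "real Matrix.mat"
  assumes A: "A \<in> carrier_mat n n" and sym: "transpose_mat A = A"
    and u: "u \<in> carrier_vec n" and z: "z \<in> carrier_vec n"
  shows "(u + z) \<bullet> (A *\<^sub>v (u + z)) = u \<bullet> (A *\<^sub>v u) + 2 * (z \<bullet> (A *\<^sub>v u)) + z \<bullet> (A *\<^sub>v z)"
proof -
  have c: "A *\<^sub>v u \<in> carrier_vec n" "A *\<^sub>v z \<in> carrier_vec n" using A u z by auto
  have "u \<bullet> (A *\<^sub>v z) = z \<bullet> (A *\<^sub>v u)"
    using symmetric_scalar_prod[OF A sym u z] comm_scalar_prod[OF c(1) z] by simp
  then show ?thesis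
    using A u z c
    by (simp add: mult_add_distrib_mat_vec[of A n n] add_scalar_prod_distrib[of _ n]
        scalar_prod_add_distrib[of _ n])
qed

text \<open>The quadratic form at \<open>u + t y\<close> is a nonnegative quadratic polynomial in \<open>t\<close>.\<close>

lemma psd_cauchy_schwarz:
  assumes A: "A \<in> carrier_mat n n" and psd: "psd_mat A"
    and u: "u \<in> carrier_vec n" and y: "y \<in> carrier_vec n"
  shows "(y \<bullet> (A *\<^sub>v u))\<^sup>2 \<le> (y \<bullet> (A *\<^sub>v y)) * (u \<bullet> (A *\<^sub>v u))"
proof -
  define p q r where "p = y \<bullet> (A *\<^sub>v y)" and "q = y \<bullet> (A *\<^sub>v u)" and "r = u \<bullet> (A *\<^sub>v u)"
  have nonneg: "0 \<le> r + 2 * (t * q) + t * (t * p)" for t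
  proof -
    have "(u + t \<cdot>\<^sub>v y) \<bullet> (A *\<^sub>v (u + t \<cdot>\<^sub>v y)) = r + 2 * (t * q) + t * (t * p)"
      using quadratic_form_add[OF A psd_matD(1)[OF A psd] u, of "t \<cdot>\<^sub>v y"] A u y
      by (simp add: mult_mat_vec[of A n n] p_def q_def r_def)
    then show ?thesis using psd_matD(2)[OF A psd, of "u + t \<cdot>\<^sub>v y"] u y by simp
  qed
  have p: "0 \<le> p" using psd_matD(2)[OF A psd y] by (simp add: p_def)
  have "q\<^sup>2 \<le> p * r"
  proof (cases "p = 0")
    case True
    have "q = 0"
    proof (rule ccontr)
      assume "q \<noteq> 0"
      then show False using nonneg[of "- (r + 1) / (2 * q)"] True by (simp add: field_simps)
    qed
    then show ?thesis using True by simp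
  next
    case False
    then have "0 \<le> r - q\<^sup>2 / p"
      using nonneg[of "- q / p"] by (simp add: power2_eq_square field_simps)
    then show ?thesis using False p by (simp add: field_simps)
  qed
  then show ?thesis by (simp add: p_def q_def r_def)
qed

lemma psd_quadratic_form_eq_0:
  assumes A: "A \<in> carrier_mat n n" and psd: "psd_mat A"
    and z: "z \<in> carrier_vec n" and 0: "z \<bullet> (A *\<^sub>v z) = 0"
  shows "A *\<^sub>v z = 0\<^sub>v n"
proof -
  have Az: "A *\<^sub>v z \<in> carrier_vec n" using A z by simp
  have "((A *\<^sub>v z) \<bullet> (A *\<^sub>v z))\<^sup>2 \<le> 0"
    using psd_cauchy_schwarz[OF A psd z Az] 0 by simp
  then show ?thesis using real_scalar_prod_self_eq_0[OF Az] by simp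
qed

lemma unit_vec_quadratic_form:
  fixes A :: "real Matrix.mat"
  assumes A: "A \<in> carrier_mat n n" and j: "j < n"
  shows "unit_vec n j \<bullet> (A *\<^sub>v unit_vec n j) = A $$ (j, j)"
proof -
  have "unit_vec n j \<bullet> (A *\<^sub>v unit_vec n j) = (A *\<^sub>v unit_vec n j) $ j"
    using A j by (subst scalar_prod_left_unit) auto
  then show ?thesis using A j by simp
qed

text \<open>Cauchy-Schwarz against a unit vector. It bounds the gain of a coordinate step by the energy,
  and it makes the \<open>j\<close>-th entry of \<open>A u\<close> vanish when \<open>A $$ (j, j) = 0\<close>, which agrees with the
  convention for division by zero in the formula for that gain.\<close>

lemma psd_coordinate_bound:
  assumes A: "A \<in> carrier_mat n n" and psd: "psd_mat A"
    and u: "u \<in> carrier_vec n" and j: "j < n"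
  shows "((A *\<^sub>v u) $ j)\<^sup>2 \<le> A $$ (j, j) * (u \<bullet> (A *\<^sub>v u))"
proof -
  have "unit_vec n j \<bullet> (A *\<^sub>v u) = (A *\<^sub>v u) $ j"
    using A u j by (subst scalar_prod_left_unit) auto
  then show ?thesis
    using psd_cauchy_schwarz[OF A psd u, of "unit_vec n j"] unit_vec_quadratic_form[OF A j] by simp
qed

lemma psd_diag_nonneg:
  assumes A: "A \<in> carrier_mat n n" and psd: "psd_mat A" and j: "j < n"
  shows "0 \<le> A $$ (j, j)"
  using psd_matD(2)[OF A psd, of "unit_vec n j"] unit_vec_quadratic_form[OF A j] by simp

text \<open>The contraction factor is nonnegative. Summing the Rayleigh bound over the unit vectors
  compares \<open>\<lambda> trace A\<close> with the squared Frobenius norm, whose terms satisfy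
  \<open>(A $$ (i, j))\<^sup>2 \<le> A $$ (i, i) * A $$ (j, j)\<close>. The common factor \<open>trace A\<close> is kept because it
  may be zero.\<close>

lemma lambda_min_pos_le_trace:
  assumes A: "A \<in> carrier_mat n n" and psd: "psd_mat A"
  shows "lambda_min_pos A * trace_mat A \<le> trace_mat A * trace_mat A"
proof -
  have row: "lambda_min_pos A * A $$ (j, j) \<le> A $$ (j, j) * trace_mat A" if j: "j < n" for j
  proof -
    let ?e = "unit_vec n j :: real Matrix.vec"
    note ejj = unit_vec_quadratic_form[OF A j]
    have "lambda_min_pos A * A $$ (j, j) \<le> (A *\<^sub>v ?e) \<bullet> (A *\<^sub>v ?e)"
      using rayleigh_lambda_min_pos[OF A psd, of ?e] by (simp add: ejj)
    also have "\<dots> = (\<Sum>i<n. ((A *\<^sub>v ?e) $ i)\<^sup>2)"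
      using A by (simp add: scalar_prod_def power2_eq_square atLeast0LessThan)
    also have "\<dots> \<le> (\<Sum>i<n. A $$ (i, i) * A $$ (j, j))"
      using psd_coordinate_bound[OF A psd, of ?e] by (intro sum_mono) (simp add: ejj)
    also have "\<dots> = A $$ (j, j) * trace_mat A"
      using A by (simp add: trace_mat_def sum_distrib_left mult.commute)
    finally show ?thesis .
  qed
  have "lambda_min_pos A * trace_mat A = (\<Sum>j<n. lambda_min_pos A * A $$ (j, j))"
    using A by (simp add: trace_mat_def sum_distrib_left)
  also have "\<dots> \<le> (\<Sum>j<n. A $$ (j, j) * trace_mat A)" by (intro sum_mono row) simp
  also have "\<dots> = trace_mat A * trace_mat A"
    using A by (simp add: sum_distrib_right trace_mat_def)
  finally show ?thesis .
qed

text \<open>The last claim says that the normal equations with matrix \<open>E\<^sup>T A E\<close> and right-hand side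
  \<open>E\<^sup>T A v\<close> are solved exactly by the pseudoinverse: a vector \<open>z\<close> in the kernel of the Gram
  matrix satisfies \<open>(E z) \<bullet> A (E z) = 0\<close>, hence \<open>A E z = 0\<close> by semidefiniteness, and so \<open>z\<close> is
  orthogonal to every right-hand side of this form. The part of the right-hand side that the
  pseudoinverse fails to solve is its orthogonal projection onto that kernel, hence zero.\<close>

lemma pinv_gram:
  assumes A: "A \<in> carrier_mat n n" and psd: "psd_mat A" and E: "E \<in> carrier_mat n m"
  defines "B \<equiv> transpose_mat E * (A * E)"
  shows "pinv B \<in> carrier_mat m m" "transpose_mat (pinv B) = pinv B"
    "\<And>v. v \<in> carrier_vec n \<Longrightarrow>
       B *\<^sub>v (pinv B *\<^sub>v (transpose_mat E *\<^sub>v (A *\<^sub>v v))) = transpose_mat E *\<^sub>v (A *\<^sub>v v)"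
proof -
  have ET: "transpose_mat E \<in> carrier_mat m n" and AE: "A * E \<in> carrier_mat n m"
    using A E by auto
  have B: "B \<in> carrier_mat m m" using ET AE by (simp add: B_def)
  have symA: "transpose_mat A = A" by (rule psd_matD(1)[OF A psd])
  have symB: "transpose_mat B = B"
    unfolding B_def using A E ET AE symA
    by (simp add: transpose_mult[of _ m n _ m] transpose_mult[of _ n n _ m] assoc_mult_mat[of _ m n _ n _ m])
  note P = pinv_symmetric[OF B symB]
  show "pinv B \<in> carrier_mat m m" "transpose_mat (pinv B) = pinv B" by (fact P)+
  fix v :: "real Matrix.vec" assume v: "v \<in> carrier_vec n"
  define G where "G = B * pinv B"
  have G: "G \<in> carrier_mat m m" "transpose_mat G = G" using B P by (auto simp: G_def)
  have "G * B = B" using P by (simp add: G_def)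
  then have "transpose_mat (G * B) = B" using symB by simp
  then have BG: "B * G = B" using B G symB by (simp add: transpose_mult[of _ m m _ m])
  define r where "r = transpose_mat E *\<^sub>v (A *\<^sub>v v)"
  define s where "s = r - G *\<^sub>v r"
  define z where "z = s - G *\<^sub>v s"
  have r: "r \<in> carrier_vec m" using ET A v by (simp add: r_def)
  have s: "s \<in> carrier_vec m" using r G by (simp add: s_def)
  have z: "z \<in> carrier_vec m" using s G by (simp add: z_def)
  \<comment> \<open>The vector z lies in the kernel of the Gram matrix B, so E z has zero A-norm.\<close>
  have "B *\<^sub>v z = B *\<^sub>v s - (B * G) *\<^sub>v s"
    using B G s by (simp add: z_def mult_minus_distrib_mat_vec[of B m m])
  then have Bz: "B *\<^sub>v z = 0\<^sub>v m" using BG B s by simp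
  have Ez: "E *\<^sub>v z \<in> carrier_vec n" using E z by simp
  have AEz: "A *\<^sub>v (E *\<^sub>v z) \<in> carrier_vec n" using A Ez by simp
  have "(E *\<^sub>v z) \<bullet> (A *\<^sub>v (E *\<^sub>v z)) = (A *\<^sub>v (E *\<^sub>v z)) \<bullet> (E *\<^sub>v z)"
    by (rule comm_scalar_prod[OF Ez AEz])
  also have "\<dots> = (transpose_mat E *\<^sub>v (A *\<^sub>v (E *\<^sub>v z))) \<bullet> z"
    by (rule transpose_vec_mult_scalar[OF E z AEz, symmetric])
  also have "transpose_mat E *\<^sub>v (A *\<^sub>v (E *\<^sub>v z)) = B *\<^sub>v z"
    unfolding B_def using ET AE A E z by (simp add: assoc_mult_mat_vec[of _ m n _ m] assoc_mult_mat_vec[of _ n n _ m])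
  finally have "(E *\<^sub>v z) \<bullet> (A *\<^sub>v (E *\<^sub>v z)) = 0" using Bz z by simp
  then have AEz0: "A *\<^sub>v (E *\<^sub>v z) = 0\<^sub>v n" by (rule psd_quadratic_form_eq_0[OF A psd Ez])
  have "s \<bullet> s = s \<bullet> (r - G *\<^sub>v r)" by (simp add: s_def)
  also have "\<dots> = s \<bullet> r - s \<bullet> (G *\<^sub>v r)"
    using r G by (intro scalar_prod_minus_distrib[OF s]) auto
  also have "s \<bullet> (G *\<^sub>v r) = (G *\<^sub>v s) \<bullet> r" by (rule symmetric_scalar_prod[OF G s r])
  also have "s \<bullet> r - (G *\<^sub>v s) \<bullet> r = z \<bullet> r"
    using s r G unfolding z_def by (subst minus_scalar_prod_distrib[of _ m]) auto
  also have "\<dots> = r \<bullet> z" by (rule comm_scalar_prod[OF z r])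
  also have "\<dots> = (A *\<^sub>v v) \<bullet> (E *\<^sub>v z)"
    unfolding r_def using A v by (intro transpose_vec_mult_scalar[OF E z]) simp
  also have "\<dots> = v \<bullet> (A *\<^sub>v (E *\<^sub>v z))" by (rule symmetric_scalar_prod[OF A symA v Ez, symmetric])
  finally have "s \<bullet> s = 0" using AEz0 v by simp
  then have "s = 0\<^sub>v m" by (rule real_scalar_prod_self_eq_0[OF s])
  then have "G *\<^sub>v r = r"
  proof (intro eq_vecI)
    fix i assume "i < dim_vec r"
    then have i: "i < m" using r by simp
    have "s $ i = 0" using \<open>s = 0\<^sub>v m\<close> i by simp
    then show "(G *\<^sub>v r) $ i = r $ i" using i r G by (simp add: s_def)
  qed (use r G in simp)
  then show "B *\<^sub>v (pinv B *\<^sub>v (transpose_mat E *\<^sub>v (A *\<^sub>v v))) = transpose_mat E *\<^sub>v (A *\<^sub>v v)"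
    using B P r by (simp add: G_def r_def[symmetric] assoc_mult_mat_vec[of _ m m _ m])
qed

section \<open>Submatrices as products with columns of the identity\<close>

lemma basis_cols_carrier: "basis_cols n J \<in> carrier_mat n (card {i. i < n \<and> i \<in> J})"
  by (simp add: basis_cols_def dim_submatrix carrier_matI)

text \<open>Column \<open>k\<close> of \<open>basis_cols n J\<close> is the unit vector of the \<open>k\<close>-th element of \<open>J\<close>. From here
  on every submatrix is a product with such matrices, and index sets disappear from the matrix
  algebra. Members of \<open>J\<close> that are at least \<open>n\<close> are never picked, so a sample outside the
  index range leaves the block unchanged.\<close>

lemma basis_cols_index:
  assumes "i < n" "k < card {i. i < n \<and> i \<in> J}"
  shows "basis_cols n J $$ (i, k) = (if i = pick J k then 1 else 0)"
proof -
  have "pick J k < n" using pick_le[OF assms(2)] .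
  then show ?thesis
    using assms unfolding basis_cols_def by (subst submatrix_index) (auto simp: pick_UNIV)
qed

lemma transpose_basis_cols_mult_vec:
  assumes v: "v \<in> carrier_vec n"
  shows "transpose_mat (basis_cols n J) *\<^sub>v v = subvec v J"
proof (rule eq_vecI)
  note E = basis_cols_carrier[of n J]
  fix k assume "k < dim_vec (subvec v J)"
  then have k: "k < card {i. i < n \<and> i \<in> J}" using v by (simp add: subvec_def)
  have "(transpose_mat (basis_cols n J) *\<^sub>v v) $ k
      = (\<Sum>i\<in>{0..<n}. basis_cols n J $$ (i, k) * v $ i)"
    using E k v by (auto simp: scalar_prod_def)
  also have "\<dots> = (\<Sum>i\<in>{0..<n}. if i = pick J k then v $ i else 0)"
    by (intro sum.cong refl) (simp add: basis_cols_index[OF _ k])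
  also have "\<dots> = v $ (pick J k)" using pick_le[OF k] by simp
  finally show "(transpose_mat (basis_cols n J) *\<^sub>v v) $ k = subvec v J $ k"
    using k v by (simp add: subvec_def)
qed (use v basis_cols_carrier[of n J] in \<open>simp add: subvec_def\<close>)

lemma submatrix_rows_eq:
  assumes A: "A \<in> carrier_mat n m"
  shows "submatrix A J UNIV = transpose_mat (basis_cols n J) * A"
proof (rule mat_col_eqI)
  note E = basis_cols_carrier[of n J]
  show "dim_row (submatrix A J UNIV) = dim_row (transpose_mat (basis_cols n J) * A)"
    "dim_col (submatrix A J UNIV) = dim_col (transpose_mat (basis_cols n J) * A)"
    using A E by (auto simp: dim_submatrix)
  fix j assume "j < dim_col (transpose_mat (basis_cols n J) * A)"
  then have j: "j < m" using A by simp
  have "col (transpose_mat (basis_cols n J) * A) j = subvec (col A j) J"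
    using A E j by (subst col_mult2[of _ _ n _ m]) (auto intro!: transpose_basis_cols_mult_vec)
  also have "\<dots> = col (submatrix A J UNIV) j"
  proof (rule eq_vecI)
    fix i assume "i < dim_vec (col (submatrix A J UNIV) j)"
    then have i: "i < card {i. i < n \<and> i \<in> J}" using A by (simp add: dim_submatrix)
    then have "submatrix A J UNIV $$ (i, j) = A $$ (pick J i, j)"
      using A j by (subst submatrix_index) (auto simp: pick_UNIV)
    then show "subvec (col A j) J $ i = col (submatrix A J UNIV) j $ i"
      using A i j pick_le[OF i] by (simp add: subvec_def dim_submatrix)
  qed (use A in \<open>simp add: subvec_def dim_submatrix\<close>)
  finally show "col (submatrix A J UNIV) j = col (transpose_mat (basis_cols n J) * A) j" by simp
qed

lemma submatrix_cols_eq: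
  assumes A: "A \<in> carrier_mat n m"
  shows "submatrix A UNIV J = A * basis_cols m J"
proof (rule eq_matI)
  note E = basis_cols_carrier[of m J]
  show "dim_row (submatrix A UNIV J) = dim_row (A * basis_cols m J)"
    "dim_col (submatrix A UNIV J) = dim_col (A * basis_cols m J)"
    using A E by (auto simp: dim_submatrix)
  fix i k assume "i < dim_row (A * basis_cols m J)" "k < dim_col (A * basis_cols m J)"
  then have i: "i < n" and k: "k < card {i. i < m \<and> i \<in> J}" using A E by auto
  have "(A * basis_cols m J) $$ (i, k) = (\<Sum>j\<in>{0..<m}. A $$ (i, j) * basis_cols m J $$ (j, k))"
    using A E i k by (auto simp: scalar_prod_def)
  also have "\<dots> = (\<Sum>j\<in>{0..<m}. if j = pick J k then A $$ (i, j) else 0)"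
    by (intro sum.cong refl) (simp add: basis_cols_index[OF _ k])
  also have "\<dots> = A $$ (i, pick J k)" using pick_le[OF k] by simp
  also have "\<dots> = submatrix A UNIV J $$ (i, k)"
    using A i k by (subst submatrix_index) (auto simp: pick_UNIV)
  finally show "submatrix A UNIV J $$ (i, k) = (A * basis_cols m J) $$ (i, k)" by simp
qed

lemma submatrix_eq:
  assumes A: "A \<in> carrier_mat n m"
  shows "submatrix A I J = transpose_mat (basis_cols n I) * (A * basis_cols m J)"
  using submatrix_split[of A I J] submatrix_cols_eq[OF A, of J]
    submatrix_rows_eq[of "A * basis_cols m J" n _ I] A basis_cols_carrier[of m J]
  by (metis mult_carrier_mat)

lemma basis_cols_mult_vec_outside:
  assumes c: "c \<in> carrier_vec (card {i. i < n \<and> i \<in> J})" and i: "i < n" "i \<notin> J"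
  shows "(basis_cols n J *\<^sub>v c) $ i = 0"
proof -
  have "pick J k \<noteq> i" if k: "k < card {i. i < n \<and> i \<in> J}" for k
  proof -
    have "infinite J \<or> k < card J"
    proof (rule disjCI)
      assume "\<not> k < card J"
      moreover have "card {i. i < n \<and> i \<in> J} \<le> card J" if "finite J"
        using that by (intro card_mono) auto
      ultimately show "infinite J" using k by linarith
    qed
    then have "pick J k \<in> J" using pick_in_set by auto
    then show ?thesis using i by auto
  qed
  then have "basis_cols n J $$ (i, k) = 0" if "k < card {i. i < n \<and> i \<in> J}" for k
    using that basis_cols_index[OF i(1) that] by auto
  then show ?thesis
    using c i basis_cols_carrier[of n J] by (auto simp: scalar_prod_def intro!: sum.neutral)
qed

lemma transpose_basis_cols_mult_vec_eq_0D:
  assumes v: "v \<in> carrier_vec n"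
    and 0: "transpose_mat (basis_cols n J) *\<^sub>v v = 0\<^sub>v (card {i. i < n \<and> i \<in> J})"
    and i: "i < n" "i \<in> J"
  shows "v $ i = 0"
proof -
  define k where "k = card {a\<in>J. a < i}"
  have pick: "pick J k = i" unfolding k_def by (rule pick_card_in_set[OF i(2)])
  have "{a\<in>J. a < i} \<subset> {a. a < n \<and> a \<in> J}" using i by auto
  then have k: "k < card {i. i < n \<and> i \<in> J}"
    unfolding k_def by (intro psubset_card_mono) auto
  then have "subvec v J $ k = v $ i" using v by (simp add: subvec_def pick)
  then show ?thesis using 0 k by (simp add: transpose_basis_cols_mult_vec[OF v])
qed

section \<open>The residual matrix and one block step\<close>

text \<open>The residual matrix is the Schur complement of \<open>A\<close> with respect to \<open>S\<close>: its rows in \<open>S\<close>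
  vanish, and it inherits semidefiniteness from \<open>A\<close> because its quadratic form at \<open>v\<close> is that of
  \<open>A\<close> at the A-orthogonal projection of \<open>v\<close> off the directions in \<open>S\<close>.\<close>

lemma residual_mat_properties:
  fixes A :: "real Matrix.mat" and S :: "nat set"
  assumes A: "A \<in> carrier_mat n n" and psd: "psd_mat A"
  defines "R \<equiv> residual_mat A S" and "E \<equiv> basis_cols n S"
  shows residual_mat_carrier: "R \<in> carrier_mat n n"
    and residual_mat_mult_vec: "\<And>v. v \<in> carrier_vec n \<Longrightarrow>
      R *\<^sub>v v = A *\<^sub>v v - A *\<^sub>v (E *\<^sub>v (pinv (submatrix A S S) *\<^sub>v (transpose_mat E *\<^sub>v (A *\<^sub>v v))))"
    and residual_mat_zero_rows: "\<And>v. v \<in> carrier_vec n \<Longrightarrow>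
      transpose_mat E *\<^sub>v (R *\<^sub>v v) = 0\<^sub>v (card {i. i < n \<and> i \<in> S})"
    and residual_mat_psd: "psd_mat R"
proof -
  define m where "m = card {i. i < n \<and> i \<in> S}"
  have E: "E \<in> carrier_mat n m" unfolding E_def m_def by (rule basis_cols_carrier)
  have ET: "transpose_mat E \<in> carrier_mat m n" and AE: "A * E \<in> carrier_mat n m"
    and EA: "transpose_mat E * A \<in> carrier_mat m n"
    using A E by auto
  note symA = psd_matD(1)[OF A psd]
  define P where "P = pinv (submatrix A S S)"
  have B: "submatrix A S S = transpose_mat E * (A * E)"
    unfolding E_def by (rule submatrix_eq[OF A])
  have P: "P \<in> carrier_mat m m" "transpose_mat P = P"
    and BP: "\<And>v. v \<in> carrier_vec n \<Longrightarrow>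
      transpose_mat E *\<^sub>v (A *\<^sub>v (E *\<^sub>v (P *\<^sub>v (transpose_mat E *\<^sub>v (A *\<^sub>v v))))) = transpose_mat E *\<^sub>v (A *\<^sub>v v)"
  proof -
    show P: "P \<in> carrier_mat m m" "transpose_mat P = P"
      unfolding P_def B using pinv_gram[OF A psd E] by auto
    fix v :: "real Matrix.vec" assume v: "v \<in> carrier_vec n"
    have "(transpose_mat E * (A * E)) *\<^sub>v (P *\<^sub>v (transpose_mat E *\<^sub>v (A *\<^sub>v v))) = transpose_mat E *\<^sub>v (A *\<^sub>v v)"
      unfolding P_def B using pinv_gram(3)[OF A psd E v] .
    then show "transpose_mat E *\<^sub>v (A *\<^sub>v (E *\<^sub>v (P *\<^sub>v (transpose_mat E *\<^sub>v (A *\<^sub>v v))))) = transpose_mat E *\<^sub>v (A *\<^sub>v v)"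
      using P A E ET AE v
      by (simp add: assoc_mult_mat_vec[of _ m n _ m] assoc_mult_mat_vec[of _ n n _ m])
  qed
  have R_eq: "R = A - A * E * P * (transpose_mat E * A)"
    unfolding R_def residual_mat_def E_def P_def
    by (simp only: submatrix_cols_eq[OF A] submatrix_rows_eq[OF A])
  show R: "R \<in> carrier_mat n n"
    unfolding R_eq by (intro minus_carrier_mat mult_carrier_mat[OF mult_carrier_mat[OF AE P(1)] EA])
  show Rv: "R *\<^sub>v v = A *\<^sub>v v - A *\<^sub>v (E *\<^sub>v (pinv (submatrix A S S) *\<^sub>v (transpose_mat E *\<^sub>v (A *\<^sub>v v))))"
    if v: "v \<in> carrier_vec n" for v
  proof -
    have AEP: "A * E * P \<in> carrier_mat n m" using AE P by simp
    have "R *\<^sub>v v = A *\<^sub>v v - (A * E * P * (transpose_mat E * A)) *\<^sub>v v"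
      unfolding R_eq using A AEP EA v by (intro minus_mult_distrib_mat_vec) auto
    also have "(A * E * P * (transpose_mat E * A)) *\<^sub>v v
        = A *\<^sub>v (E *\<^sub>v (P *\<^sub>v (transpose_mat E *\<^sub>v (A *\<^sub>v v))))"
      using A E ET AE EA AEP P v by (simp only: assoc_mult_mat_vec[OF AEP EA v]
        assoc_mult_mat_vec[OF ET A v] assoc_mult_mat_vec[OF AE P(1)] assoc_mult_mat_vec[OF A E] mult_mat_vec_carrier)
    finally show ?thesis by (simp add: P_def)
  qed
  show zero: "transpose_mat E *\<^sub>v (R *\<^sub>v v) = 0\<^sub>v (card {i. i < n \<and> i \<in> S})"
    if v: "v \<in> carrier_vec n" for v
  proof -
    let ?y = "A *\<^sub>v (E *\<^sub>v (P *\<^sub>v (transpose_mat E *\<^sub>v (A *\<^sub>v v))))"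
    have y: "?y \<in> carrier_vec n" using A E ET P v by simp
    have "transpose_mat E *\<^sub>v (R *\<^sub>v v) = transpose_mat E *\<^sub>v (A *\<^sub>v v) - transpose_mat E *\<^sub>v ?y"
      unfolding Rv[OF v] P_def[symmetric] using ET A v y by (intro mult_minus_distrib_mat_vec) auto
    then show ?thesis unfolding BP[OF v] using ET A v by (simp add: m_def)
  qed
  have symR: "transpose_mat R = R"
  proof -
    have AEP: "A * E * P \<in> carrier_mat n m" using AE P by simp
    have "transpose_mat (A * E * P * (transpose_mat E * A))
        = transpose_mat (transpose_mat E * A) * transpose_mat (A * E * P)"
      by (rule transpose_mult[OF AEP EA])
    also have "transpose_mat (transpose_mat E * A) = A * E"
      using transpose_mult[OF ET A] symA by simp
    also have "transpose_mat (A * E * P) = P * (transpose_mat E * A)"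
      using transpose_mult[OF AE P(1)] transpose_mult[OF A E] symA P by simp
    also have "A * E * (P * (transpose_mat E * A)) = A * E * P * (transpose_mat E * A)"
      by (rule assoc_mult_mat[OF AE P(1) EA, symmetric])
    finally have sym: "transpose_mat (A * E * P * (transpose_mat E * A)) = A * E * P * (transpose_mat E * A)" .
    show ?thesis
      unfolding R_eq using AEP EA A
      by (subst transpose_minus[of _ n n]) (auto simp: sym symA)
  qed
  have "0 \<le> v \<bullet> (R *\<^sub>v v)" if v: "v \<in> carrier_vec n" for v
  proof -
    let ?c = "P *\<^sub>v (transpose_mat E *\<^sub>v (A *\<^sub>v v))"
    have c: "?c \<in> carrier_vec m" using P ET A v by simp
    have Ec: "E *\<^sub>v ?c \<in> carrier_vec n" using E c by simp
    have Rvc: "R *\<^sub>v v \<in> carrier_vec n" using R v by simp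
    \<comment> \<open>The A-orthogonal complement v' of the coordinate directions in S satisfies
        A v' = R v, and so its A-norm is the R-norm of v.\<close>
    let ?v = "v - E *\<^sub>v ?c"
    have "A *\<^sub>v ?v = R *\<^sub>v v"
      unfolding Rv[OF v] P_def[symmetric] using A v Ec by (rule mult_minus_distrib_mat_vec)
    then have "?v \<bullet> (A *\<^sub>v ?v) = v \<bullet> (R *\<^sub>v v) - (E *\<^sub>v ?c) \<bullet> (R *\<^sub>v v)"
      using minus_scalar_prod_distrib[OF v Ec Rvc] by simp
    also have "(E *\<^sub>v ?c) \<bullet> (R *\<^sub>v v) = (R *\<^sub>v v) \<bullet> (E *\<^sub>v ?c)" by (rule comm_scalar_prod[OF Ec Rvc])
    also have "\<dots> = (transpose_mat E *\<^sub>v (R *\<^sub>v v)) \<bullet> ?c"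
      by (rule transpose_vec_mult_scalar[OF E c Rvc, symmetric])
    also have "\<dots> = 0" using zero[OF v] c by (simp add: m_def)
    finally show ?thesis using psd_matD(2)[OF A psd, of ?v] v Ec by simp
  qed
  then show "psd_mat R" using symR R by (simp add: psd_mat_def)
qed

text \<open>The squared seminorm; unlike \<open>mat_norm\<close> it is free of the square root.\<close>

definition energy :: "real Matrix.mat \<Rightarrow> real Matrix.vec \<Rightarrow> real" where
  "energy A v = v \<bullet> (A *\<^sub>v v)"

text \<open>The hypothesis says that an iterate with error \<open>e\<close> solves the equations of \<open>S\<close>; it annihilates
  the term that the Schur complement subtracts from \<open>A e\<close>.\<close>

lemma residual_mat_mult_vec_eq:
  assumes A: "A \<in> carrier_mat n n" and psd: "psd_mat A" and e: "e \<in> carrier_vec n"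
    and S0: "transpose_mat (basis_cols n S) *\<^sub>v (A *\<^sub>v e) = 0\<^sub>v (card {i. i < n \<and> i \<in> S})"
  shows "residual_mat A S *\<^sub>v e = A *\<^sub>v e"
proof -
  define m E where "m = card {i. i < n \<and> i \<in> S}" and "E = basis_cols n S"
  have E: "E \<in> carrier_mat n m" unfolding E_def m_def by (rule basis_cols_carrier)
  have "pinv (submatrix A S S) \<in> carrier_mat m m"
    unfolding submatrix_eq[OF A] E_def[symmetric] by (rule pinv_gram(1)[OF A psd E])
  then have "pinv (submatrix A S S) *\<^sub>v 0\<^sub>v m = 0\<^sub>v m" "E *\<^sub>v 0\<^sub>v m = 0\<^sub>v n" "A *\<^sub>v 0\<^sub>v n = 0\<^sub>v n"
    using E A by (auto intro!: eq_vecI)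
  then show ?thesis
    unfolding residual_mat_mult_vec[OF A psd e] using S0 A e
    by (simp add: E_def[symmetric] m_def[symmetric])
qed

text \<open>The new error is \<open>u\<close> plus a combination of the directions in \<open>S\<close>, where
  \<open>u = e - F \<alpha>\<close> changes the old error only inside the block. That combination is invisible to
  \<open>R\<close> and makes \<open>A\<close> act as \<open>R\<close>, so the new energy is the \<open>R\<close>-energy of \<open>u\<close>. The choice of
  \<open>\<alpha>\<close> makes the gradient \<open>R u\<close> vanish on the block, and the zero rows of \<open>R\<close> keep the
  equations of \<open>S\<close> solved.\<close>

lemma block_step_as_minimizer:
  fixes A :: "real Matrix.mat" and S J :: "nat set"
  assumes A: "A \<in> carrier_mat n n" and psd: "psd_mat A"
    and xs: "xs \<in> carrier_vec n" and x: "x \<in> carrier_vec n"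
    and S0: "transpose_mat (basis_cols n S) *\<^sub>v (A *\<^sub>v (x - xs)) = 0\<^sub>v (card {i. i < n \<and> i \<in> S})"
  defines "R \<equiv> residual_mat A S" and "x' \<equiv> block_step A (A *\<^sub>v xs) S J x"
  shows "\<exists>u \<in> carrier_vec n. x' \<in> carrier_vec n \<and> A *\<^sub>v (x' - xs) = R *\<^sub>v u \<and>
    energy A (x' - xs) = energy R u \<and>
    (\<forall>i<n. i \<notin> J \<longrightarrow> u $ i = (x - xs) $ i) \<and>
    (\<forall>i<n. i \<in> J \<longrightarrow> (R *\<^sub>v u) $ i = 0) \<and>
    transpose_mat (basis_cols n S) *\<^sub>v (A *\<^sub>v (x' - xs)) = 0\<^sub>v (card {i. i < n \<and> i \<in> S})"
proof -
  define E F where "E = basis_cols n S" and "F = basis_cols n J"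
  define m k where "m = card {i. i < n \<and> i \<in> S}" and "k = card {i. i < n \<and> i \<in> J}"
  have E: "E \<in> carrier_mat n m" and F: "F \<in> carrier_mat n k"
    unfolding E_def m_def F_def k_def by (rule basis_cols_carrier)+
  have ET: "transpose_mat E \<in> carrier_mat m n" and FT: "transpose_mat F \<in> carrier_mat k n"
    using E F by auto
  note R = residual_mat_carrier[OF A psd, of S, folded R_def]
  note psdR = residual_mat_psd[OF A psd, of S, folded R_def]
  define P where "P = pinv (submatrix A S S)"
  have P: "P \<in> carrier_mat m m"
    unfolding P_def submatrix_eq[OF A] E_def[symmetric] by (rule pinv_gram(1)[OF A psd E])
  note Rv = residual_mat_mult_vec[OF A psd, of _ S, folded R_def P_def E_def]
  note ER = residual_mat_zero_rows[OF A psd, of _ S, folded R_def E_def m_def]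
  define P' where "P' = pinv (submatrix R J J)"
  have P': "P' \<in> carrier_mat k k"
    unfolding P'_def submatrix_eq[OF R] F_def[symmetric] by (rule pinv_gram(1)[OF R psdR F])
  define e where "e = x - xs"
  have e: "e \<in> carrier_vec n" using x xs by (simp add: e_def)
  have Ae: "A *\<^sub>v e \<in> carrier_vec n" using A e by simp
  have Re: "R *\<^sub>v e = A *\<^sub>v e"
    unfolding R_def by (rule residual_mat_mult_vec_eq[OF A psd e]) (use S0 in \<open>simp add: e_def\<close>)
  define \<alpha> where "\<alpha> = P' *\<^sub>v (submatrix A J UNIV *\<^sub>v x - subvec (A *\<^sub>v xs) J)"
  define \<beta> where "\<beta> = P *\<^sub>v (submatrix A S J *\<^sub>v \<alpha>)"
  have "submatrix A J UNIV *\<^sub>v x - subvec (A *\<^sub>v xs) J = transpose_mat F *\<^sub>v (A *\<^sub>v x) - transpose_mat F *\<^sub>v (A *\<^sub>v xs)"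
    using A FT x xs F unfolding submatrix_rows_eq[OF A] F_def[symmetric]
    by (simp add: assoc_mult_mat_vec[OF FT A] transpose_basis_cols_mult_vec[of _ n J, folded F_def])
  also have "\<dots> = transpose_mat F *\<^sub>v (A *\<^sub>v x - A *\<^sub>v xs)"
    using FT A x xs by (intro mult_minus_distrib_mat_vec[symmetric]) auto
  also have "A *\<^sub>v x - A *\<^sub>v xs = R *\<^sub>v e"
    unfolding Re unfolding e_def using A x xs by (intro mult_minus_distrib_mat_vec[symmetric]) auto
  finally have \<alpha>: "\<alpha> = P' *\<^sub>v (transpose_mat F *\<^sub>v (R *\<^sub>v e))" by (simp add: \<alpha>_def)
  have \<alpha>c: "\<alpha> \<in> carrier_vec k" unfolding \<alpha> using P' FT R e by simp
  define a where "a = F *\<^sub>v \<alpha>"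
  have a: "a \<in> carrier_vec n" using F \<alpha>c by (simp add: a_def)
  have "submatrix A S J *\<^sub>v \<alpha> = transpose_mat E *\<^sub>v (A *\<^sub>v a)"
  proof -
    have AF: "A * F \<in> carrier_mat n k" using A F by simp
    show ?thesis
      unfolding submatrix_eq[OF A] E_def[symmetric] F_def[symmetric] a_def
      by (simp only: assoc_mult_mat_vec[OF ET AF \<alpha>c] assoc_mult_mat_vec[OF A F \<alpha>c])
  qed
  then have \<beta>: "\<beta> = P *\<^sub>v (transpose_mat E *\<^sub>v (A *\<^sub>v a))" by (simp add: \<beta>_def)
  have \<beta>c: "\<beta> \<in> carrier_vec m" unfolding \<beta> using P ET A a by simp
  define c where "c = E *\<^sub>v \<beta>"
  have c: "c \<in> carrier_vec n" using E \<beta>c by (simp add: c_def)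
  have Ra: "R *\<^sub>v a = A *\<^sub>v a - A *\<^sub>v c" using Rv[OF a] by (simp add: c_def \<beta>)
  have x': "x' = x - a + c"
    using A by (simp add: x'_def block_step_def Let_def R_def[symmetric] P'_def[symmetric]
        P_def[symmetric] \<alpha>_def[symmetric] \<beta>_def[symmetric] E_def[symmetric] F_def[symmetric] a_def c_def)
  define u where "u = e - a"
  have u: "u \<in> carrier_vec n" using e a by (simp add: u_def)
  have x'c: "x' \<in> carrier_vec n" using x a c by (simp add: x')
  have x'u: "x' - xs = u + c" using x xs a c by (intro eq_vecI) (auto simp: x' u_def e_def)
  have Ru: "R *\<^sub>v u = R *\<^sub>v e - R *\<^sub>v a"
    unfolding u_def using R e a by (rule mult_minus_distrib_mat_vec)
  have Au: "A *\<^sub>v u = A *\<^sub>v e - A *\<^sub>v a"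
    unfolding u_def using A e a by (rule mult_minus_distrib_mat_vec)
  have carr: "A *\<^sub>v a \<in> carrier_vec n" "A *\<^sub>v c \<in> carrier_vec n" using A a c by auto
  have Ax': "A *\<^sub>v (x' - xs) = R *\<^sub>v u"
  proof -
    have "A *\<^sub>v (x' - xs) = A *\<^sub>v u + A *\<^sub>v c"
      unfolding x'u using A u c by (rule mult_add_distrib_mat_vec)
    also have "\<dots> = R *\<^sub>v u"
      unfolding Ru Au Re Ra using carr Ae by (intro eq_vecI) auto
    finally show ?thesis .
  qed
  have Ruc: "R *\<^sub>v u \<in> carrier_vec n" using R u by simp
  have "transpose_mat F *\<^sub>v (R *\<^sub>v u) = transpose_mat F *\<^sub>v (R *\<^sub>v e) - transpose_mat F *\<^sub>v (R *\<^sub>v a)"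
    unfolding Ru using FT R e a by (intro mult_minus_distrib_mat_vec) auto
  also have "transpose_mat F *\<^sub>v (R *\<^sub>v a) = transpose_mat F *\<^sub>v (R *\<^sub>v e)"
  proof -
    have RF: "R * F \<in> carrier_mat n k" using R F by simp
    have "transpose_mat F *\<^sub>v (R *\<^sub>v a) = (transpose_mat F * (R * F)) *\<^sub>v \<alpha>"
      unfolding a_def by (simp only: assoc_mult_mat_vec[OF FT RF \<alpha>c] assoc_mult_mat_vec[OF R F \<alpha>c])
    also have "\<dots> = transpose_mat F *\<^sub>v (R *\<^sub>v e)"
      unfolding \<alpha> P'_def submatrix_eq[OF R] F_def[symmetric] by (rule pinv_gram(3)[OF R psdR F e])
    finally show ?thesis .
  qed
  finally have FRu: "transpose_mat F *\<^sub>v (R *\<^sub>v u) = 0\<^sub>v k" using FT R e by simp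
  show ?thesis
  proof (intro bexI[OF _ u] conjI allI impI)
    show "x' \<in> carrier_vec n" "A *\<^sub>v (x' - xs) = R *\<^sub>v u" by (fact x'c Ax')+
    have "energy A (x' - xs) = (u + c) \<bullet> (R *\<^sub>v u)" unfolding energy_def Ax' unfolding x'u ..
    also have "\<dots> = energy R u + c \<bullet> (R *\<^sub>v u)"
      unfolding energy_def by (rule add_scalar_prod_distrib[OF u c Ruc])
    also have "c \<bullet> (R *\<^sub>v u) = (R *\<^sub>v u) \<bullet> c" by (rule comm_scalar_prod[OF c Ruc])
    also have "\<dots> = (transpose_mat E *\<^sub>v (R *\<^sub>v u)) \<bullet> \<beta>"
      unfolding c_def by (rule transpose_vec_mult_scalar[OF E \<beta>c Ruc, symmetric])
    also have "\<dots> = 0" using ER[OF u] \<beta>c by simp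
    finally show "energy A (x' - xs) = energy R u" by simp
    show "transpose_mat (basis_cols n S) *\<^sub>v (A *\<^sub>v (x' - xs)) = 0\<^sub>v (card {i. i < n \<and> i \<in> S})"
      unfolding Ax' using ER[OF u] by (simp add: E_def m_def)
    show "u $ i = (x - xs) $ i" if "i < n" "i \<notin> J" for i
    proof -
      have "a $ i = 0"
        using basis_cols_mult_vec_outside[OF _ that, of \<alpha>] \<alpha>c by (simp add: a_def F_def k_def)
      then show ?thesis using that e a by (simp add: u_def e_def[symmetric])
    qed
    show "(R *\<^sub>v u) $ i = 0" if "i < n" "i \<in> J" for i
      using transpose_basis_cols_mult_vec_eq_0D[OF Ruc _ that] FRu by (simp add: F_def k_def)
  qed
qed

text \<open>A vanishing gradient on the block characterizes the minimizer of the convex form: the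
  cross term of the quadratic expansion at \<open>u\<close> is zero for every competitor.\<close>

lemma block_step_energy_le:
  assumes A: "A \<in> carrier_mat n n" and psd: "psd_mat A"
    and xs: "xs \<in> carrier_vec n" and x: "x \<in> carrier_vec n"
    and S0: "transpose_mat (basis_cols n S) *\<^sub>v (A *\<^sub>v (x - xs)) = 0\<^sub>v (card {i. i < n \<and> i \<in> S})"
    and y: "y \<in> carrier_vec n" and eq: "\<And>i. i < n \<Longrightarrow> i \<notin> J \<Longrightarrow> y $ i = (x - xs) $ i"
  shows "energy A (block_step A (A *\<^sub>v xs) S J x - xs) \<le> energy (residual_mat A S) y"
proof -
  let ?R = "residual_mat A S"
  note R = residual_mat_carrier[OF A psd, of S] and psdR = residual_mat_psd[OF A psd, of S]
  obtain u where u: "u \<in> carrier_vec n"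
    and energy: "energy A (block_step A (A *\<^sub>v xs) S J x - xs) = energy ?R u"
    and off: "\<And>i. i < n \<Longrightarrow> i \<notin> J \<Longrightarrow> u $ i = (x - xs) $ i"
    and on: "\<And>i. i < n \<Longrightarrow> i \<in> J \<Longrightarrow> (?R *\<^sub>v u) $ i = 0"
    using block_step_as_minimizer[OF A psd xs x S0, where J = J] by blast
  define z where "z = y - u"
  have z: "z \<in> carrier_vec n" using y u by (simp add: z_def)
  have yz: "y = u + z" using y u by (intro eq_vecI) (auto simp: z_def)
  have "z \<bullet> (?R *\<^sub>v u) = (\<Sum>i\<in>{0..<n}. z $ i * (?R *\<^sub>v u) $ i)"
    using R u by (simp add: scalar_prod_def)
  also have "\<dots> = 0"
  proof (rule sum.neutral, rule ballI)
    fix i assume "i \<in> {0..<n}"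
    then have i: "i < n" by simp
    show "z $ i * (?R *\<^sub>v u) $ i = 0"
    proof (cases "i \<in> J")
      case True then show ?thesis using on[OF i] by simp
    next
      case False then show ?thesis using eq[OF i] off[OF i] i u y by (simp add: z_def)
    qed
  qed
  finally have "energy ?R y = energy ?R u + energy ?R z"
    using quadratic_form_add[OF R psd_matD(1)[OF R psdR] u z] by (simp add: energy_def yz)
  moreover have "0 \<le> energy ?R z" unfolding energy_def by (rule psd_matD(2)[OF R psdR z])
  ultimately show ?thesis using energy by simp
qed


text \<open>A larger block minimizes over more coordinates, so it is at least as good as keeping the old
  minimizer \<open>u\<close>, and at least as good as following it by an exact line search along the new
  coordinate \<open>j\<close>.\<close>

lemma block_step_insert_energy_le:
  fixes A :: "real Matrix.mat" and S J :: "nat set"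
  assumes A: "A \<in> carrier_mat n n" and psd: "psd_mat A"
    and xs: "xs \<in> carrier_vec n" and x: "x \<in> carrier_vec n"
    and S0: "transpose_mat (basis_cols n S) *\<^sub>v (A *\<^sub>v (x - xs)) = 0\<^sub>v (card {i. i < n \<and> i \<in> S})"
  defines "step \<equiv> \<lambda>J. block_step A (A *\<^sub>v xs) S J x"
  shows "energy A (step (insert j J) - xs) \<le> energy A (step J - xs)"
    and "j < n \<Longrightarrow> energy A (step (insert j J) - xs)
      \<le> energy A (step J - xs) - ((A *\<^sub>v (step J - xs)) $ j)\<^sup>2 / residual_mat A S $$ (j, j)"
    and "energy A (step {} - xs) \<le> energy A (x - xs)"
proof -
  let ?R = "residual_mat A S"
  note R = residual_mat_carrier[OF A psd, of S] and psdR = residual_mat_psd[OF A psd, of S]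
  have best: "energy A (step K - xs) \<le> energy ?R y"
    if "y \<in> carrier_vec n" "\<And>i. i < n \<Longrightarrow> i \<notin> K \<Longrightarrow> y $ i = (x - xs) $ i" for y K
    unfolding step_def by (rule block_step_energy_le[OF A psd xs x S0 that])
  obtain u where u: "u \<in> carrier_vec n"
    and res: "A *\<^sub>v (step J - xs) = ?R *\<^sub>v u"
    and energy: "energy A (step J - xs) = energy ?R u"
    and off: "\<And>i. i < n \<Longrightarrow> i \<notin> J \<Longrightarrow> u $ i = (x - xs) $ i"
    unfolding step_def using block_step_as_minimizer[OF A psd xs x S0, where J = J] by blast
  show "energy A (step (insert j J) - xs) \<le> energy A (step J - xs)"
    unfolding energy by (rule best[OF u]) (use off in auto)
  show "energy A (step (insert j J) - xs)
      \<le> energy A (step J - xs) - ((A *\<^sub>v (step J - xs)) $ j)\<^sup>2 / ?R $$ (j, j)" if j: "j < n"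
  proof -
    let ?r = "(?R *\<^sub>v u) $ j" and ?d = "?R $$ (j, j)"
    let ?e = "unit_vec n j :: real Matrix.vec"
    define t where "t = ?r / ?d"
    \<comment> \<open>The exact line search; for a zero diagonal entry t is 0 and the claimed gain is 0 as well.\<close>
    let ?y = "u + (- t) \<cdot>\<^sub>v ?e"
    have eRu: "?e \<bullet> (?R *\<^sub>v u) = ?r" using R u j by (subst scalar_prod_left_unit) auto
    note eRe = unit_vec_quadratic_form[OF R j]
    have y: "?y \<in> carrier_vec n" using u by simp
    have "energy ?R ?y = energy ?R u - 2 * (t * ?r) + t * (t * ?d)"
      using quadratic_form_add[OF R psd_matD(1)[OF R psdR] u, of "(- t) \<cdot>\<^sub>v ?e"] R u
      by (simp add: energy_def mult_mat_vec[of ?R n n] eRu eRe del: uminus_vec_def)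
    also have "\<dots> = energy ?R u - ?r\<^sup>2 / ?d"
      by (cases "?d = 0") (simp_all add: t_def power2_eq_square)
    finally have 1: "energy ?R ?y = energy ?R u - ?r\<^sup>2 / ?d" .
    have "energy A (step (insert j J) - xs) \<le> energy ?R ?y"
    proof (rule best[OF y])
      fix i assume i: "i < n" "i \<notin> insert j J"
      then show "?y $ i = (x - xs) $ i" using u off[OF i(1)] j by simp
    qed
    then show ?thesis unfolding energy res 1 .
  qed
  have "?R *\<^sub>v (x - xs) = A *\<^sub>v (x - xs)"
    using x xs by (intro residual_mat_mult_vec_eq[OF A psd _ S0]) simp
  then show "energy A (step {} - xs) \<le> energy A (x - xs)"
    using best[of "x - xs" "{}"] x xs by (simp add: energy_def)
qed

text \<open>The weights \<open>R $$ (j, j) / trace R\<close> cancel the denominators of the coordinate gains; the sum is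
  \<open>(R u \<bullet> R u) / trace R\<close>, to which the Rayleigh bound applies.\<close>

lemma sampled_decrease_rate:
  fixes A :: "real Matrix.mat" and S J :: "nat set"
  assumes A: "A \<in> carrier_mat n n" and psd: "psd_mat A"
    and xs: "xs \<in> carrier_vec n" and x: "x \<in> carrier_vec n"
    and S0: "transpose_mat (basis_cols n S) *\<^sub>v (A *\<^sub>v (x - xs)) = 0\<^sub>v (card {i. i < n \<and> i \<in> S})"
  defines "R \<equiv> residual_mat A S" and "x' \<equiv> block_step A (A *\<^sub>v xs) S J x"
  shows "lambda_min_pos R / trace_mat R * energy A (x' - xs)
      \<le> (\<Sum>j<n. R $$ (j, j) / trace_mat R * (((A *\<^sub>v (x' - xs)) $ j)\<^sup>2 / R $$ (j, j)))"
    and "j < n \<Longrightarrow> ((A *\<^sub>v (x' - xs)) $ j)\<^sup>2 / R $$ (j, j) \<le> energy A (x' - xs)"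
proof -
  note R = residual_mat_carrier[OF A psd, of S, folded R_def]
  note psdR = residual_mat_psd[OF A psd, of S, folded R_def]
  obtain u where u: "u \<in> carrier_vec n"
    and res: "A *\<^sub>v (x' - xs) = R *\<^sub>v u"
    and energy: "energy A (x' - xs) = energy R u"
    unfolding R_def x'_def using block_step_as_minimizer[OF A psd xs x S0, where J = J] by blast
  have tr: "0 \<le> trace_mat R"
    using R psd_diag_nonneg[OF R psdR] by (auto simp: trace_mat_def intro!: sum_nonneg)
  have "lambda_min_pos R * energy R u / trace_mat R \<le> ((R *\<^sub>v u) \<bullet> (R *\<^sub>v u)) / trace_mat R"
    unfolding energy_def using rayleigh_lambda_min_pos[OF R psdR u] tr by (rule divide_right_mono)
  also have "\<dots> = (\<Sum>j<n. ((R *\<^sub>v u) $ j)\<^sup>2 / trace_mat R)"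
    using R by (simp add: scalar_prod_def power2_eq_square atLeast0LessThan sum_divide_distrib)
  also have "\<dots> = (\<Sum>j<n. R $$ (j, j) / trace_mat R * (((R *\<^sub>v u) $ j)\<^sup>2 / R $$ (j, j)))"
  proof (rule sum.cong[OF refl])
    fix j assume "j \<in> {..<n}"
    then have "((R *\<^sub>v u) $ j)\<^sup>2 \<le> R $$ (j, j) * (u \<bullet> (R *\<^sub>v u))"
      using psd_coordinate_bound[OF R psdR u] by simp
    then show "((R *\<^sub>v u) $ j)\<^sup>2 / trace_mat R
        = R $$ (j, j) / trace_mat R * (((R *\<^sub>v u) $ j)\<^sup>2 / R $$ (j, j))"
      by (cases "R $$ (j, j) = 0") auto
  qed
  finally show "lambda_min_pos R / trace_mat R * energy A (x' - xs)
      \<le> (\<Sum>j<n. R $$ (j, j) / trace_mat R * (((A *\<^sub>v (x' - xs)) $ j)\<^sup>2 / R $$ (j, j)))"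
    unfolding energy res by simp
  show "((A *\<^sub>v (x' - xs)) $ j)\<^sup>2 / R $$ (j, j) \<le> energy A (x' - xs)" if j: "j < n"
  proof (cases "R $$ (j, j) = 0")
    case True
    moreover have "0 \<le> energy R u" unfolding energy_def by (rule psd_matD(2)[OF R psdR u])
    ultimately show ?thesis by (simp add: energy)
  next
    case False
    then have "0 < R $$ (j, j)" using psd_diag_nonneg[OF R psdR j] by simp
    then show ?thesis
      unfolding res unfolding energy unfolding energy_def using psd_coordinate_bound[OF R psdR u j]
      by (simp add: divide_le_eq mult.commute)
  qed
qed

section \<open>Expected decrease driven by a fresh independent index\<close>

context prob_space
begin

text \<open>A finite history of natural numbers is a discrete random variable, so measurability is free
  for everything computed from it. The matrix iterates need no measurable structure of their
  own.\<close>

lemma borel_measurable_PiM_count_space: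
  fixes f :: "('i \<Rightarrow> nat) \<Rightarrow> real"
  assumes "finite A"
  shows "f \<in> borel_measurable (PiM A (\<lambda>_. count_space UNIV))"
  using assms by (simp add: count_space_PiM_finite)

lemma measurable_finite_history:
  fixes Z :: "'i \<Rightarrow> 'a \<Rightarrow> nat" and f :: "('i \<Rightarrow> nat) \<Rightarrow> real"
  assumes A: "finite A" and Z: "\<And>p. p \<in> A \<Longrightarrow> Z p \<in> measurable M (count_space UNIV)"
    and f: "\<And>h. f (restrict h A) = f h"
  shows "(\<lambda>w. f (\<lambda>p. Z p w)) \<in> borel_measurable M"
proof -
  have "(\<lambda>w. restrict (\<lambda>p. Z p w) A) \<in> measurable M (PiM A (\<lambda>_. count_space UNIV))"
    using Z by (intro measurable_restrict) auto
  moreover have "f \<in> borel_measurable (PiM A (\<lambda>_. count_space UNIV))"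
    by (rule borel_measurable_PiM_count_space[OF A])
  ultimately have "(\<lambda>w. f (restrict (\<lambda>p. Z p w) A)) \<in> borel_measurable M"
    by (rule measurable_compose)
  then show ?thesis by (simp add: f)
qed

lemma integrable_finite_history:
  fixes Z :: "'i \<Rightarrow> 'a \<Rightarrow> nat" and f :: "('i \<Rightarrow> nat) \<Rightarrow> real"
  assumes A: "finite A" and Z: "\<And>p. p \<in> A \<Longrightarrow> Z p \<in> measurable M (count_space UNIV)"
    and f: "\<And>h. f (restrict h A) = f h" and C: "\<And>h. \<bar>f h\<bar> \<le> C"
  shows "integrable M (\<lambda>w. f (\<lambda>p. Z p w))"
proof (rule integrable_const_bound[of _ C])
  show "(\<lambda>w. f (\<lambda>p. Z p w)) \<in> borel_measurable M"
    by (rule measurable_finite_history[where A = A]) (use A Z f in \<open>blast+\<close>)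
qed (use C in simp)

text \<open>\<open>V\<close> and \<open>gain\<close> are determined by the history indexed by \<open>A\<close>, while \<open>V'\<close> may also look at the
  fresh index \<open>Z q\<close>. By independence the expectation of \<open>gain (Z q)\<close> splits into the sum of
  the expectations of \<open>gain j\<close> weighted with the law of \<open>Z q\<close>, to which the pointwise bound
  \<open>rate\<close> applies. No gain is claimed for indices outside \<open>{..<n}\<close>.\<close>

lemma expected_decrease:
  fixes Z :: "'i \<Rightarrow> 'a \<Rightarrow> nat" and V V' :: "('i \<Rightarrow> nat) \<Rightarrow> real"
    and gain :: "nat \<Rightarrow> ('i \<Rightarrow> nat) \<Rightarrow> real" and C \<rho> :: real
  assumes indep: "indep_vars (\<lambda>_. count_space UNIV) Z I"
    and A: "finite A" "A \<subseteq> I" and q: "q \<in> I" "q \<notin> A"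
    and V: "\<And>h. V (restrict h A) = V h" "\<And>h. \<bar>V h\<bar> \<le> C"
    and V': "\<And>h. V' (restrict h (insert q A)) = V' h" "\<And>h. \<bar>V' h\<bar> \<le> C"
    and gain: "\<And>j h. gain j (restrict h A) = gain j h" "\<And>j h. j < n \<Longrightarrow> \<bar>gain j h\<bar> \<le> C"
    and le: "\<And>h. V' h \<le> V h" and decrease: "\<And>h. h q < n \<Longrightarrow> V' h \<le> V h - gain (h q) h"
    and rate: "\<And>h. \<rho> * V h \<le> (\<Sum>j<n. prob {w \<in> space M. Z q w = j} * gain j h)"
  shows "expectation (\<lambda>w. V' (\<lambda>p. Z p w)) \<le> (1 - \<rho>) * expectation (\<lambda>w. V (\<lambda>p. Z p w))"
proof -
  have Z: "Z p \<in> measurable M (count_space UNIV)" if "p \<in> I" for p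
    using indep that by (auto simp: indep_vars_def)
  let ?z = "\<lambda>w p. Z p w"
  let ?P = "\<lambda>j. prob {w \<in> space M. Z q w = j}"
  have intV: "integrable M (\<lambda>w. V (?z w))"
    by (rule integrable_finite_history[where A = A and C = C]) (use A Z V in \<open>blast+\<close>)
  have intV': "integrable M (\<lambda>w. V' (?z w))"
    by (rule integrable_finite_history[where A = "insert q A" and C = C]) (use A q Z V' in \<open>blast+\<close>)
  have intG: "integrable M (\<lambda>w. gain j (?z w))" if "j < n" for j
    by (rule integrable_finite_history[where A = A and C = C]) (use A Z gain that in \<open>blast+\<close>)
  have intI: "integrable M (\<lambda>w. of_bool (Z q w = j) :: real)" for j
    using q Z by (intro integrable_finite_history[of "{q}" Z "\<lambda>h. of_bool (h q = j)" 1]) auto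
  have EI: "expectation (\<lambda>w. of_bool (Z q w = j)) = ?P j" for j
  proof -
    have "{w \<in> space M. Z q w = j} \<in> events"
      using measurable_sets[OF Z[OF q(1)], of "{j}"] by (simp add: vimage_def Int_def conj_commute)
    moreover have "expectation (\<lambda>w. of_bool (Z q w = j) :: real)
        = expectation (indicator {w \<in> space M. Z q w = j})"
      by (intro Bochner_Integration.integral_cong) (auto simp: indicator_def)
    ultimately show ?thesis by simp
  qed
  have indep_gain: "indep_var borel (\<lambda>w. gain j (?z w)) borel (\<lambda>w. of_bool (Z q w = j) :: real)" for j
  proof -
    have "indep_var (PiM A (\<lambda>_. count_space UNIV)) (\<lambda>w. restrict (?z w) A)
        (PiM {q} (\<lambda>_. count_space UNIV)) (\<lambda>w. restrict (?z w) {q})"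
      using indep A q by (intro indep_var_restrict) auto
    from this borel_measurable_PiM_count_space[OF A(1)]
      borel_measurable_PiM_count_space[OF finite.insertI[OF finite.emptyI]]
    have "indep_var borel (gain j \<circ> (\<lambda>w. restrict (?z w) A))
        borel ((\<lambda>h. of_bool (h q = j) :: real) \<circ> (\<lambda>w. restrict (?z w) {q}))"
      by (rule indep_var_compose)
    then show ?thesis by (simp add: comp_def gain)
  qed
  have prod: "expectation (\<lambda>w. gain j (?z w) * of_bool (Z q w = j)) = expectation (\<lambda>w. gain j (?z w)) * ?P j"
    "integrable M (\<lambda>w. gain j (?z w) * of_bool (Z q w = j))" if "j < n" for j
    using indep_var_lebesgue_integral[OF indep_gain intG[OF that] intI]
      indep_var_integrable[OF indep_gain intG[OF that] intI] by (simp_all add: EI)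
  have "expectation (\<lambda>w. V' (?z w))
      \<le> expectation (\<lambda>w. V (?z w) - (\<Sum>j<n. gain j (?z w) * of_bool (Z q w = j)))"
  proof (rule integral_mono)
    fix w
    have "(\<Sum>j<n. gain j (?z w) * of_bool (Z q w = j))
        = (\<Sum>j<n. if j = Z q w then gain (Z q w) (?z w) else 0)"
      by (intro sum.cong) auto
    also have "\<dots> = (if Z q w < n then gain (Z q w) (?z w) else 0)" by simp
    finally have "(\<Sum>j<n. gain j (?z w) * of_bool (Z q w = j))
        = (if Z q w < n then gain (Z q w) (?z w) else 0)" .
    then show "V' (?z w) \<le> V (?z w) - (\<Sum>j<n. gain j (?z w) * of_bool (Z q w = j))"
      using le[of "?z w"] decrease[of "?z w"] by (cases "Z q w < n") (simp_all only: if_True if_False diff_0_right)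
  next
    show "integrable M (\<lambda>w. V (?z w) - (\<Sum>j<n. gain j (?z w) * of_bool (Z q w = j)))"
      by (intro Bochner_Integration.integrable_diff Bochner_Integration.integrable_sum intV prod(2)) simp
  qed (rule intV')
  also have "\<dots> = expectation (\<lambda>w. V (?z w)) - (\<Sum>j<n. expectation (\<lambda>w. gain j (?z w)) * ?P j)"
  proof -
    let ?G = "\<lambda>w. \<Sum>j<n. gain j (?z w) * of_bool (Z q w = j)"
    have "integrable M ?G" by (intro Bochner_Integration.integrable_sum prod(2)) simp
    then have "expectation (\<lambda>w. V (?z w) - ?G w) = expectation (\<lambda>w. V (?z w)) - expectation ?G"
      by (rule Bochner_Integration.integral_diff[OF intV])
    also have "expectation ?G = (\<Sum>j<n. expectation (\<lambda>w. gain j (?z w) * of_bool (Z q w = j)))"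
      by (rule Bochner_Integration.integral_sum, rule prod(2)) simp
    also have "\<dots> = (\<Sum>j<n. expectation (\<lambda>w. gain j (?z w)) * ?P j)"
      by (intro sum.cong refl prod(1)) simp
    finally show ?thesis .
  qed
  also have "\<dots> = expectation (\<lambda>w. V (?z w)) - expectation (\<lambda>w. \<Sum>j<n. ?P j * gain j (?z w))"
    using intG by (simp add: Bochner_Integration.integral_sum mult.commute)
  also have "\<dots> \<le> expectation (\<lambda>w. V (?z w)) - expectation (\<lambda>w. \<rho> * V (?z w))"
    using intV intG rate by (intro diff_left_mono integral_mono) auto
  finally show ?thesis by (simp add: algebra_simps)
qed

end

section \<open>The iterates as functions of the sampled indices\<close>

text \<open>The deterministic run of the method along a realization \<open>h\<close> of all sampled indices; \<open>h (k, i)\<close>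
  is the \<open>i\<close>-th index of block \<open>k\<close>.\<close>

primrec block_iterate ::
  "real Matrix.mat \<Rightarrow> real Matrix.vec \<Rightarrow> nat set \<Rightarrow> nat \<Rightarrow> real Matrix.vec \<Rightarrow> (nat \<times> nat \<Rightarrow> nat) \<Rightarrow> nat \<Rightarrow> real Matrix.vec"
where
  "block_iterate A b S l x0 h 0 = x0"
| "block_iterate A b S l x0 h (Suc k)
     = block_step A b S ((\<lambda>i. h (k, i)) ` {..<l}) (block_iterate A b S l x0 h k)"

text \<open>The energy after \<open>k\<close> full blocks and one further step that uses only the first \<open>i\<close> indices of
  block \<open>k\<close>. It interpolates between consecutive iterates and changes by one sampled index at a
  time.\<close>

definition partial_energy ::
  "real Matrix.mat \<Rightarrow> real Matrix.vec \<Rightarrow> nat set \<Rightarrow> nat \<Rightarrow> real Matrix.vec \<Rightarrow> nat \<Rightarrow> nat \<Rightarrow> (nat \<times> nat \<Rightarrow> nat) \<Rightarrow> real"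
where
  "partial_energy A xs S l x0 k i h =
     energy A (block_step A (A *\<^sub>v xs) S ((\<lambda>i'. h (k, i')) ` {..<i})
       (block_iterate A (A *\<^sub>v xs) S l x0 h k) - xs)"

definition sampled_before :: "nat \<Rightarrow> nat \<Rightarrow> nat \<Rightarrow> (nat \<times> nat) set" where
  "sampled_before l k i = {..<k} \<times> {..<l} \<union> {k} \<times> {..<i}"

lemma block_iterate_cong:
  assumes "\<And>k' i. k' < k \<Longrightarrow> i < l \<Longrightarrow> h (k', i) = h' (k', i)"
  shows "block_iterate A b S l x0 h k = block_iterate A b S l x0 h' k"
  using assms
proof (induction k)
  case (Suc k)
  have "(\<lambda>i. h (k, i)) ` {..<l} = (\<lambda>i. h' (k, i)) ` {..<l}"
    using Suc.prems by (intro image_cong) auto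
  moreover have "block_iterate A b S l x0 h k = block_iterate A b S l x0 h' k"
    by (rule Suc.IH) (use Suc.prems in auto)
  ultimately show ?case by simp
qed simp

lemma history_restrict:
  "block_iterate A b S l x0 (restrict h (sampled_before l k i)) k = block_iterate A b S l x0 h k"
  "(\<lambda>i'. restrict h (sampled_before l k i) (k, i')) ` {..<i} = (\<lambda>i'. h (k, i')) ` {..<i}"
  by (rule block_iterate_cong, simp add: sampled_before_def)
     (rule image_cong, simp_all add: sampled_before_def)

lemma block_iterate_exact_on:
  assumes A: "A \<in> carrier_mat n n" and psd: "psd_mat A"
    and xs: "xs \<in> carrier_vec n" and x0: "x0 \<in> carrier_vec n"
    and S0: "transpose_mat (basis_cols n S) *\<^sub>v (A *\<^sub>v (x0 - xs)) = 0\<^sub>v (card {i. i < n \<and> i \<in> S})"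
  shows "block_iterate A (A *\<^sub>v xs) S l x0 h k \<in> carrier_vec n \<and>
    transpose_mat (basis_cols n S) *\<^sub>v (A *\<^sub>v (block_iterate A (A *\<^sub>v xs) S l x0 h k - xs))
      = 0\<^sub>v (card {i. i < n \<and> i \<in> S})"
proof (induction k)
  case 0
  then show ?case using x0 S0 by simp
next
  case (Suc k)
  let ?x = "block_iterate A (A *\<^sub>v xs) S l x0 h k" and ?J = "(\<lambda>i. h (k, i)) ` {..<l}"
  have x: "?x \<in> carrier_vec n"
    and Sx: "transpose_mat (basis_cols n S) *\<^sub>v (A *\<^sub>v (?x - xs)) = 0\<^sub>v (card {i. i < n \<and> i \<in> S})"
    using Suc.IH by auto
  show ?case
    using block_step_as_minimizer[OF A psd xs x Sx, where J = ?J] by (auto simp del: index_minus_vec)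
qed

lemma energy_nonneg:
  assumes "A \<in> carrier_mat n n" "psd_mat A" "v \<in> carrier_vec n"
  shows "0 \<le> energy A v"
  unfolding energy_def using assms by (intro psd_matD(2)) auto

lemma mat_norm_square:
  assumes "A \<in> carrier_mat n n" "psd_mat A" "v \<in> carrier_vec n"
  shows "(mat_norm A v)\<^sup>2 = energy A v"
  using energy_nonneg[OF assms] by (simp add: mat_norm_def energy_def)

text \<open>Along the indices in order of sampling, \<open>partial_energy\<close> contracts in expectation by
  \<open>1 - \<rho>\<close> per index. All energies are bounded by the initial one since no step increases them,
  so integrability is automatic.\<close>

lemma expected_energy_bound:
  fixes Z :: "nat \<times> nat \<Rightarrow> 'w \<Rightarrow> nat" and M :: "'w measure"
  assumes M: "prob_space M"
    and indep: "prob_space.indep_vars M (\<lambda>_. count_space UNIV) Z (UNIV \<times> {..<l})"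
    and A: "A \<in> carrier_mat n n" and psd: "psd_mat A"
    and xs: "xs \<in> carrier_vec n" and x0: "x0 \<in> carrier_vec n"
    and S0: "transpose_mat (basis_cols n S) *\<^sub>v (A *\<^sub>v (x0 - xs)) = 0\<^sub>v (card {i. i < n \<and> i \<in> S})"
    and prob: "\<And>k i j. i < l \<Longrightarrow> j < n \<Longrightarrow>
      measure M {w \<in> space M. Z (k, i) w = j} = residual_mat A S $$ (j, j) / trace_mat (residual_mat A S)"
  defines "\<rho> \<equiv> lambda_min_pos (residual_mat A S) / trace_mat (residual_mat A S)"
  shows "(\<integral>w. energy A (block_iterate A (A *\<^sub>v xs) S l x0 (\<lambda>p. Z p w) k - xs) \<partial>M)
    \<le> (1 - \<rho>) ^ (k * l) * energy A (x0 - xs)"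
proof -
  interpret prob_space M by (rule M)
  let ?R = "residual_mat A S"
  note R = residual_mat_carrier[OF A psd, of S] and psdR = residual_mat_psd[OF A psd, of S]
  let ?x = "\<lambda>h k. block_iterate A (A *\<^sub>v xs) S l x0 h k"
  let ?y = "\<lambda>h k i. block_step A (A *\<^sub>v xs) S ((\<lambda>i'. h (k, i')) ` {..<i}) (?x h k)"
  let ?V = "partial_energy A xs S l x0"
  define C where "C = energy A (x0 - xs)"
  have Z: "Z p \<in> measurable M (count_space UNIV)" if "p \<in> UNIV \<times> {..<l}" for p
    using indep that by (auto simp: indep_vars_def)
  have x: "?x h k \<in> carrier_vec n"
    and Sx: "transpose_mat (basis_cols n S) *\<^sub>v (A *\<^sub>v (?x h k - xs)) = 0\<^sub>v (card {i. i < n \<and> i \<in> S})"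
    for h k using block_iterate_exact_on[OF A psd xs x0 S0] by auto
  have y: "?y h k i \<in> carrier_vec n" for h k i
    using block_step_as_minimizer[OF A psd xs x Sx, where J = "(\<lambda>i'. h (k, i')) ` {..<i}"] by blast
  note insert = block_step_insert_energy_le[OF A psd xs x Sx]
  have image_Suc: "(\<lambda>i'. h (k, i')) ` {..<Suc i} = insert (h (k, i)) ((\<lambda>i'. h (k, i')) ` {..<i})"
    for h :: "nat \<times> nat \<Rightarrow> nat" and k i by (auto simp: lessThan_Suc)
  have V_Suc: "?V k (Suc i) h \<le> ?V k i h" for k i h
    unfolding partial_energy_def image_Suc by (rule insert(1))
  have V_gain: "?V k (Suc i) h \<le> ?V k i h - ((A *\<^sub>v (?y h k i - xs)) $ h (k, i))\<^sup>2 / ?R $$ (h (k, i), h (k, i))"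
    if "h (k, i) < n" for k i h
    unfolding partial_energy_def image_Suc by (rule insert(2)[OF that])
  have V_0: "?V k 0 h \<le> energy A (?x h k - xs)" for k h
    using insert(3) by (simp add: partial_energy_def)
  have V_l: "?V k l h = energy A (?x h (Suc k) - xs)" for k h
    by (simp add: partial_energy_def)
  have V_mono: "?V k i h \<le> energy A (?x h k - xs)" for k i h
  proof (induction i)
    case 0 show ?case by (rule V_0)
  next
    case (Suc i) then show ?case using V_Suc[of k i h] by linarith
  qed
  have x_le: "energy A (?x h k - xs) \<le> C" for h k
  proof (induction k)
    case 0 show ?case by (simp add: C_def)
  next
    case (Suc k) then show ?case using V_mono[of k l h] V_l[of k h] by linarith
  qed
  have V_nonneg: "0 \<le> ?V k i h" for k i h
    unfolding partial_energy_def using y xs by (intro energy_nonneg[OF A psd]) simp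
  have V_abs: "\<bar>?V k i h\<bar> \<le> C" for k i h
    using V_nonneg[of k i h] V_mono[of k i h] x_le[of h k] by linarith
  have V_restrict: "?V k i (restrict h (sampled_before l k i)) = ?V k i h" for k i h
    by (simp only: partial_energy_def history_restrict)
  have fin: "finite (sampled_before l k i)" for k i by (simp add: sampled_before_def)
  have sub: "sampled_before l k i \<subseteq> UNIV \<times> {..<l}" if "i \<le> l" for k i
    using that by (auto simp: sampled_before_def)
  have before_Suc: "sampled_before l k (Suc i) = insert (k, i) (sampled_before l k i)" for k i
    by (auto simp: sampled_before_def lessThan_Suc)
  have step: "expectation (\<lambda>w. ?V k (Suc i) (\<lambda>p. Z p w)) \<le> (1 - \<rho>) * expectation (\<lambda>w. ?V k i (\<lambda>p. Z p w))"
    if i: "i < l" for k i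
  proof (rule expected_decrease[OF indep fin[of k i] sub[of i k],
        where q = "(k, i)" and n = n and C = C and
          gain = "\<lambda>j h. ((A *\<^sub>v (?y h k i - xs)) $ j)\<^sup>2 / ?R $$ (j, j)"])
    show "i \<le> l" using i by simp
    show "(k, i) \<in> UNIV \<times> {..<l}" using i by simp
    show "(k, i) \<notin> sampled_before l k i" by (simp add: sampled_before_def)
    show "?V k (Suc i) (restrict h (insert (k, i) (sampled_before l k i))) = ?V k (Suc i) h" for h
      using V_restrict[of k "Suc i" h] by (simp only: before_Suc)
    show "((A *\<^sub>v (?y (restrict h (sampled_before l k i)) k i - xs)) $ j)\<^sup>2 / ?R $$ (j, j)
        = ((A *\<^sub>v (?y h k i - xs)) $ j)\<^sup>2 / ?R $$ (j, j)" for j h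
      by (simp only: history_restrict)
    show "\<bar>((A *\<^sub>v (?y h k i - xs)) $ j)\<^sup>2 / ?R $$ (j, j)\<bar> \<le> C" if j: "j < n" for j h
    proof -
      have "0 \<le> ((A *\<^sub>v (?y h k i - xs)) $ j)\<^sup>2 / ?R $$ (j, j)"
        using psd_diag_nonneg[OF R psdR j] by simp
      moreover have "((A *\<^sub>v (?y h k i - xs)) $ j)\<^sup>2 / ?R $$ (j, j) \<le> ?V k i h"
        unfolding partial_energy_def by (rule sampled_decrease_rate(2)[OF A psd xs x Sx j])
      ultimately show ?thesis using V_abs[of k i h] by linarith
    qed
    show "\<rho> * ?V k i h \<le> (\<Sum>j<n. prob {w \<in> space M. Z (k, i) w = j} *
        (((A *\<^sub>v (?y h k i - xs)) $ j)\<^sup>2 / ?R $$ (j, j)))" for h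
    proof -
      have "(\<Sum>j<n. prob {w \<in> space M. Z (k, i) w = j} * (((A *\<^sub>v (?y h k i - xs)) $ j)\<^sup>2 / ?R $$ (j, j)))
        = (\<Sum>j<n. ?R $$ (j, j) / trace_mat ?R * (((A *\<^sub>v (?y h k i - xs)) $ j)\<^sup>2 / ?R $$ (j, j)))"
        using prob i by (intro sum.cong refl) simp
      then show ?thesis
        unfolding partial_energy_def \<rho>_def
        using sampled_decrease_rate(1)[OF A psd xs x Sx, where J = "(\<lambda>i'. h (k, i')) ` {..<i}"] by simp
    qed
    show "?V k i (restrict h (sampled_before l k i)) = ?V k i h" for h by (rule V_restrict)
    show "\<bar>?V k i h\<bar> \<le> C" "\<bar>?V k (Suc i) h\<bar> \<le> C" "?V k (Suc i) h \<le> ?V k i h" for h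
      by (rule V_abs V_Suc)+
    show "?V k (Suc i) h \<le> ?V k i h - ((A *\<^sub>v (?y h k i - xs)) $ h (k, i))\<^sup>2 / ?R $$ (h (k, i), h (k, i))"
      if "h (k, i) < n" for h using that by (rule V_gain)
  qed
  have rate: "0 \<le> 1 - \<rho>"
  proof -
    have tr: "0 \<le> trace_mat ?R"
      using R psd_diag_nonneg[OF R psdR] by (auto simp: trace_mat_def intro!: sum_nonneg)
    show ?thesis
    proof (cases "trace_mat ?R = 0")
      case False
      then have "0 < trace_mat ?R" using tr by simp
      then show ?thesis using lambda_min_pos_le_trace[OF R psdR] by (simp add: \<rho>_def)
    qed (simp add: \<rho>_def)
  qed
  have block: "expectation (\<lambda>w. ?V k i (\<lambda>p. Z p w)) \<le> (1 - \<rho>) ^ i * expectation (\<lambda>w. ?V k 0 (\<lambda>p. Z p w))"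
    if "i \<le> l" for k i
    using that
  proof (induction i)
    case (Suc i)
    have "expectation (\<lambda>w. ?V k (Suc i) (\<lambda>p. Z p w)) \<le> (1 - \<rho>) * expectation (\<lambda>w. ?V k i (\<lambda>p. Z p w))"
      using Suc.prems by (intro step) simp
    also have "\<dots> \<le> (1 - \<rho>) * ((1 - \<rho>) ^ i * expectation (\<lambda>w. ?V k 0 (\<lambda>p. Z p w)))"
      using Suc.IH Suc.prems rate by (intro mult_left_mono) auto
    finally show ?case by (simp add: mult.assoc)
  qed simp
  have int: "integrable M (\<lambda>w. ?V k i (\<lambda>p. Z p w))" if "i \<le> l" for k i
  proof (rule integrable_finite_history[where A = "sampled_before l k i" and C = C])
    show "Z p \<in> measurable M (count_space UNIV)" if "p \<in> sampled_before l k i" for p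
      using Z sub[OF \<open>i \<le> l\<close>] that by blast
  qed (use fin V_restrict V_abs in blast)+
  have int_x: "integrable M (\<lambda>w. energy A (?x (\<lambda>p. Z p w) k - xs))" for k
    using int[of l] by (cases k) (simp_all add: V_l)
  show ?thesis
  proof (induction k)
    case 0 show ?case by (simp add: prob_space)
  next
    case (Suc k)
    have "expectation (\<lambda>w. energy A (?x (\<lambda>p. Z p w) (Suc k) - xs))
        \<le> (1 - \<rho>) ^ l * expectation (\<lambda>w. ?V k 0 (\<lambda>p. Z p w))"
      using block[of l k] by (simp only: V_l order_refl simp_thms)
    also have "\<dots> \<le> (1 - \<rho>) ^ l * expectation (\<lambda>w. energy A (?x (\<lambda>p. Z p w) k - xs))"
      using rate by (intro mult_left_mono integral_mono int int_x V_0) auto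
    also have "\<dots> \<le> (1 - \<rho>) ^ l * ((1 - \<rho>) ^ (k * l) * energy A (x0 - xs))"
      using Suc.IH rate by (intro mult_left_mono) auto
    finally show ?case by (simp add: power_add mult.assoc)
  qed
qed

section \<open>Convergence\<close>

theorem theorem3p2:
  fixes A :: "real Matrix.mat" and b xstar x0 :: "real Matrix.vec"
    and n l :: nat and S :: "nat set"
    and M :: "'w measure" and J :: "nat \<Rightarrow> nat \<Rightarrow> 'w \<Rightarrow> nat"
    and X :: "nat \<Rightarrow> 'w \<Rightarrow> real Matrix.vec"
  assumes "A \<in> carrier_mat n n" and "psd_mat A"
    and "b \<in> carrier_vec n"
    and "xstar \<in> carrier_vec n" and "A *\<^sub>v xstar = b"
    and "S \<subseteq> {..<n}"
    and "residual_mat A S \<noteq> 0\<^sub>m n n"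
    and "x0 \<in> carrier_vec n" and "submatrix A S UNIV *\<^sub>v x0 = subvec b S"
    and "prob_space M"
    and "prob_space.indep_vars M (\<lambda>_. count_space UNIV) (\<lambda>(k, i). J k i) (UNIV \<times> {..<l})"
    and "\<And>k i j. i < l \<Longrightarrow> j < n \<Longrightarrow>
           measure M {w \<in> space M. J k i w = j}
             = residual_mat A S $$ (j, j) / trace_mat (residual_mat A S)"
    and "\<And>w. w \<in> space M \<Longrightarrow> X 0 w = x0"
    and "\<And>k w. w \<in> space M \<Longrightarrow>
           X (Suc k) w = block_step A b S ((\<lambda>i. J k i w) ` {..<l}) (X k w)"
  shows "\<forall>k. (\<integral>w. (mat_norm A (X k w - xstar))\<^sup>2 \<partial>M)
           \<le> (1 - lambda_min_pos (residual_mat A S) / trace_mat (residual_mat A S)) ^ (k * l)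
              * (mat_norm A (x0 - xstar))\<^sup>2"
proof
  fix k
  note A = assms(1) and psd = assms(2) and xs = assms(4) and x0 = assms(8)
  define Z where "Z = (\<lambda>(k, i). J k i)"
  let ?E = "transpose_mat (basis_cols n S)"
  have ET: "?E \<in> carrier_mat (card {i. i < n \<and> i \<in> S}) n" using basis_cols_carrier[of n S] by simp
  have S0: "?E *\<^sub>v (A *\<^sub>v (x0 - xstar)) = 0\<^sub>v (card {i. i < n \<and> i \<in> S})"
  proof -
    have "?E *\<^sub>v (A *\<^sub>v x0) = ?E *\<^sub>v b"
      using assms(9) unfolding submatrix_rows_eq[OF A]
      by (simp only: assoc_mult_mat_vec[OF ET A x0] transpose_basis_cols_mult_vec[OF assms(3)])
    moreover have "?E *\<^sub>v (A *\<^sub>v (x0 - xstar)) = ?E *\<^sub>v (A *\<^sub>v x0) - ?E *\<^sub>v (A *\<^sub>v xstar)"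
      using A ET x0 xs
      by (simp add: mult_minus_distrib_mat_vec[OF A] mult_minus_distrib_mat_vec[OF ET])
    ultimately show ?thesis using ET assms(3,5) by simp
  qed
  have X: "X k w = block_iterate A (A *\<^sub>v xstar) S l x0 (\<lambda>p. Z p w) k" if "w \<in> space M" for w k
    using assms(5,13,14) that by (induction k) (auto simp: Z_def)
  have "(\<integral>w. (mat_norm A (X k w - xstar))\<^sup>2 \<partial>M)
      = (\<integral>w. energy A (block_iterate A (A *\<^sub>v xstar) S l x0 (\<lambda>p. Z p w) k - xstar) \<partial>M)"
  proof (rule Bochner_Integration.integral_cong[OF refl])
    fix w assume "w \<in> space M"
    then show "(mat_norm A (X k w - xstar))\<^sup>2
        = energy A (block_iterate A (A *\<^sub>v xstar) S l x0 (\<lambda>p. Z p w) k - xstar)"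
      using block_iterate_exact_on[OF A psd xs x0 S0] xs
      by (subst mat_norm_square[OF A psd]) (auto simp: X)
  qed
  also have "\<dots> \<le> (1 - lambda_min_pos (residual_mat A S) / trace_mat (residual_mat A S)) ^ (k * l)
      * energy A (x0 - xstar)"
    using assms(10,11,12) by (intro expected_energy_bound[OF _ _ A psd xs x0 S0]) (auto simp: Z_def)
  also have "energy A (x0 - xstar) = (mat_norm A (x0 - xstar))\<^sup>2"
    using x0 xs by (intro mat_norm_square[OF A psd, symmetric]) simp
  finally show "(\<integral>w. (mat_norm A (X k w - xstar))\<^sup>2 \<partial>M)
      \<le> (1 - lambda_min_pos (residual_mat A S) / trace_mat (residual_mat A S)) ^ (k * l)
         * (mat_norm A (x0 - xstar))\<^sup>2" .
qed

end
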